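(* Let $\Lambda$ be a row-finite $k$-graph with no sources and let $\{t_\lambda:\lambda\in\Lambda\}$ be the universal Toeplitz-Cuntz-Krieger $\Lambda$-family generating $TC^*(\Lambda)$. Let $K,L$ be nonempty subsets of $\{1,\ldots,k\}$ and define $$A:=\Big\{\prod_{i\in K}\Big(t_v-\sum_{e\in v\Lambda^{e_i}}t_et_e^*\Big):v\in\Lambda^0\Big\},\qquad B:=\Big\{\prod_{j\in L}\Big(t_v-\sum_{e\in v\Lambda^{e_j}}t_et_e^*\Big):v\in\Lambda^0\Big\}.$$ Then the diagram $$\begin{array}{ccccccccc} & & 0 & & 0 & & 0 & & \\ & & \downarrow & & \downarrow & & \downarrow & & \\ 0&\rightarrow&\langle AB\rangle&\rightarrow&\langle A\rangle&\rightarrow&\frac{\langle A\cup B\rangle}{\langle B\rangle}&\rightarrow&0\\ & & \downarrow & & \downarrow & & \downarrow & & \\ 0&\rightarrow&\langle B\rangle&\rightarrow&TC^*(\Lambda)&\rightarrow&\frac{TC^*(\Lambda)}{\langle B\rangle}&\rightarrow&0\\ & & \downarrow & & \downarrow & & \downarrow & & \\ 0&\rightarrow&\frac{\langle A\cup B\rangle}{\langle A\rangle}&\rightarrow&\frac{TC^*(\Lambda)}{\langle A\rangle}&\rightarrow&\frac{TC^*(\Lambda)}{\langle A\cup B\rangle}&\rightarrow&0\\ & & \downarrow & & \downarrow & & \downarrow & & \\ & & 0 & & 0 & & 0 & & \end{array}$$ whose maps are the canonical ones (inclusions of ideals, quotient maps, and the maps these induce on quotients), is commutative and all its rows and columns are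 exact.
   Context: A $k$-graph ($k\ge 1$) is a countable category $\Lambda$ with a functor $d:\Lambda\to\mathbb{N}^k$ such that whenever $d(\lambda)=m+n$ there are unique $\mu,\nu\in\Lambda$ with $\lambda=\mu\nu$, $d(\mu)=m$, $d(\nu)=n$; write $\lambda(0,m)=\mu$. $\Lambda^n:=d^{-1}(n)$; $\Lambda^0$ is identified with the objects (vertices); $r,s:\Lambda\to\Lambda^0$ are codomain and domain, so $\lambda\mu$ is defined iff $s(\lambda)=r(\mu)$. $e_1,\dots,e_k$ is the standard basis of $\mathbb{N}^k$; $v\Lambda^n:=\{\lambda\in\Lambda^n:r(\lambda)=v\}$. $\Lambda$ is row-finite if every $v\Lambda^{e_i}$ is finite; it has no sources if $v\Lambda^m\neq\emptyset$ for all $v\in\Lambda^0$, $m\in\mathbb{N}^k$. $\Lambda^{\min}(\lambda,\mu)$ is the set of pairs $(\lambda',\mu')$ with $\lambda\lambda'=\mu\mu'$ and $d(\lambda\lambda')=d(\lambda)\vee d(\mu)$ (coordinatewise maximum). A Toeplitz-Cuntz-Krieger $\Lambda$-family in a $C^*$-algebra is a collection $\{T_\lambda:\lambda\in\Lambda\}$ of partial isometries such that: (TCK1) $\{T_v:v\in\Lambda^0\}$ are mutually orthogonal projections; (TCK2) $T_\lambda T_\mu=T_{\lambda\mu}$ whenever $s(\lambda)=r(\mu)$; (TCK3) $T_\lambda^*T_\mu=\sum_{(\lambda',\mu')\in\Lambda^{\min}(\lambda,\mu)}T_{\lambda'}T_{\mu'}^*$ for all $\lambda,\mu$ (empty sums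 are $0$). $TC^*(\Lambda)$ is the $C^*$-algebra generated by a universal such family $\{t_\lambda\}$. The projections $t_\lambda t_\lambda^*$ commute. For $C\subseteq TC^*(\Lambda)$, $\langle C\rangle$ is the closed two-sided ideal of $TC^*(\Lambda)$ generated by $C$; $AB:=\{ab:a\in A,b\in B\}$. *)

theory Defs
  imports
    Complex_Main
    "HOL-Library.Countable_Set"
    "HOL-Algebra.Module"
    "HOL-Algebra.QuotRing"
    "HOL-Algebra.Algebraic_Closure_Type"
begin

section \<open>C*-algebras\<close>

text \<open>
  A C*-algebra need not have a unit. As for modules in HOL-Algebra, the field \<open>one\<close> that is
  inherited from the record of rings carries no meaning and is never used.
\<close>

record 'a cstar = "(complex, 'a) module" +
  adj :: "'a \<Rightarrow> 'a"
  cnorm :: "'a \<Rightarrow> real"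

locale cstar_algebra = module "ring_of_type_algebra :: complex ring" A
  for A :: "('a, 'm) cstar_scheme" (structure) +
  assumes mult_closed: "x \<in> carrier A \<Longrightarrow> y \<in> carrier A \<Longrightarrow> x \<otimes>\<^bsub>A\<^esub> y \<in> carrier A"
    and mult_assoc: "x \<in> carrier A \<Longrightarrow> y \<in> carrier A \<Longrightarrow> z \<in> carrier A \<Longrightarrow>
          (x \<otimes>\<^bsub>A\<^esub> y) \<otimes>\<^bsub>A\<^esub> z = x \<otimes>\<^bsub>A\<^esub> (y \<otimes>\<^bsub>A\<^esub> z)"
    and distrib_right: "x \<in> carrier A \<Longrightarrow> y \<in> carrier A \<Longrightarrow> z \<in> carrier A \<Longrightarrow>
          (x \<oplus>\<^bsub>A\<^esub> y) \<otimes>\<^bsub>A\<^esub> z = (x \<otimes>\<^bsub>A\<^esub> z) \<oplus>\<^bsub>A\<^esub> (y \<otimes>\<^bsub>A\<^esub> z)"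
    and distrib_left: "x \<in> carrier A \<Longrightarrow> y \<in> carrier A \<Longrightarrow> z \<in> carrier A \<Longrightarrow>
          x \<otimes>\<^bsub>A\<^esub> (y \<oplus>\<^bsub>A\<^esub> z) = (x \<otimes>\<^bsub>A\<^esub> y) \<oplus>\<^bsub>A\<^esub> (x \<otimes>\<^bsub>A\<^esub> z)"
    and smult_mult_left: "x \<in> carrier A \<Longrightarrow> y \<in> carrier A \<Longrightarrow>
          (c \<odot>\<^bsub>A\<^esub> x) \<otimes>\<^bsub>A\<^esub> y = c \<odot>\<^bsub>A\<^esub> (x \<otimes>\<^bsub>A\<^esub> y)"
    and smult_mult_right: "x \<in> carrier A \<Longrightarrow> y \<in> carrier A \<Longrightarrow>
          x \<otimes>\<^bsub>A\<^esub> (c \<odot>\<^bsub>A\<^esub> y) = c \<odot>\<^bsub>A\<^esub> (x \<otimes>\<^bsub>A\<^esub> y)"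
    and adj_closed: "x \<in> carrier A \<Longrightarrow> adj A x \<in> carrier A"
    and adj_adj: "x \<in> carrier A \<Longrightarrow> adj A (adj A x) = x"
    and adj_add: "x \<in> carrier A \<Longrightarrow> y \<in> carrier A \<Longrightarrow>
          adj A (x \<oplus>\<^bsub>A\<^esub> y) = adj A x \<oplus>\<^bsub>A\<^esub> adj A y"
    and adj_smult: "x \<in> carrier A \<Longrightarrow> adj A (c \<odot>\<^bsub>A\<^esub> x) = cnj c \<odot>\<^bsub>A\<^esub> adj A x"
    and adj_mult: "x \<in> carrier A \<Longrightarrow> y \<in> carrier A \<Longrightarrow>
          adj A (x \<otimes>\<^bsub>A\<^esub> y) = adj A y \<otimes>\<^bsub>A\<^esub> adj A x"
    and cnorm_nonneg: "x \<in> carrier A \<Longrightarrow> 0 \<le> cnorm A x"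
    and cnorm_eq_0: "x \<in> carrier A \<Longrightarrow> cnorm A x = 0 \<longleftrightarrow> x = \<zero>\<^bsub>A\<^esub>"
    and cnorm_triangle: "x \<in> carrier A \<Longrightarrow> y \<in> carrier A \<Longrightarrow>
          cnorm A (x \<oplus>\<^bsub>A\<^esub> y) \<le> cnorm A x + cnorm A y"
    and cnorm_smult: "x \<in> carrier A \<Longrightarrow> cnorm A (c \<odot>\<^bsub>A\<^esub> x) = cmod c * cnorm A x"
    and cnorm_mult: "x \<in> carrier A \<Longrightarrow> y \<in> carrier A \<Longrightarrow>
          cnorm A (x \<otimes>\<^bsub>A\<^esub> y) \<le> cnorm A x * cnorm A y"
    and cstar_identity: "x \<in> carrier A \<Longrightarrow> cnorm A (adj A x \<otimes>\<^bsub>A\<^esub> x) = (cnorm A x)\<^sup>2"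
    and complete: "\<And>s :: nat \<Rightarrow> 'a. range s \<subseteq> carrier A \<Longrightarrow>
          (\<forall>\<epsilon>>0. \<exists>N. \<forall>m\<ge>N. \<forall>n\<ge>N. cnorm A (s m \<ominus>\<^bsub>A\<^esub> s n) < \<epsilon>) \<Longrightarrow>
          \<exists>x\<in>carrier A. (\<lambda>n. cnorm A (s n \<ominus>\<^bsub>A\<^esub> x)) \<longlonglongrightarrow> 0"

definition star_hom :: "('a, 'm) cstar_scheme \<Rightarrow> ('b, 'n) cstar_scheme \<Rightarrow> ('a \<Rightarrow> 'b) \<Rightarrow> bool" where
  "star_hom A B f \<longleftrightarrow>
     f \<in> carrier A \<rightarrow> carrier B \<and>
     (\<forall>x\<in>carrier A. \<forall>y\<in>carrier A. f (x \<oplus>\<^bsub>A\<^esub> y) = f x \<oplus>\<^bsub>B\<^esub> f y) \<and>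
     (\<forall>x\<in>carrier A. \<forall>y\<in>carrier A. f (x \<otimes>\<^bsub>A\<^esub> y) = f x \<otimes>\<^bsub>B\<^esub> f y) \<and>
     (\<forall>c. \<forall>x\<in>carrier A. f (c \<odot>\<^bsub>A\<^esub> x) = c \<odot>\<^bsub>B\<^esub> f x) \<and>
     (\<forall>x\<in>carrier A. f (adj A x) = adj B (f x))"

definition norm_closed :: "('a, 'm) cstar_scheme \<Rightarrow> 'a set \<Rightarrow> bool" where
  "norm_closed A S \<longleftrightarrow>
     (\<forall>x\<in>carrier A. (\<forall>\<epsilon>>0. \<exists>y\<in>S. cnorm A (x \<ominus>\<^bsub>A\<^esub> y) < \<epsilon>) \<longrightarrow> x \<in> S)"

definition closed_subspace :: "('a, 'm) cstar_scheme \<Rightarrow> 'a set \<Rightarrow> bool" where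
  "closed_subspace A S \<longleftrightarrow>
     S \<subseteq> carrier A \<and> \<zero>\<^bsub>A\<^esub> \<in> S \<and>
     (\<forall>x\<in>S. \<forall>y\<in>S. x \<oplus>\<^bsub>A\<^esub> y \<in> S) \<and>
     (\<forall>c. \<forall>x\<in>S. c \<odot>\<^bsub>A\<^esub> x \<in> S) \<and>
     norm_closed A S"

definition cstar_subalgebra :: "('a, 'm) cstar_scheme \<Rightarrow> 'a set \<Rightarrow> bool" where
  "cstar_subalgebra A S \<longleftrightarrow>
     closed_subspace A S \<and> (\<forall>x\<in>S. \<forall>y\<in>S. x \<otimes>\<^bsub>A\<^esub> y \<in> S) \<and> (\<forall>x\<in>S. adj A x \<in> S)"

definition closed_ideal :: "('a, 'm) cstar_scheme \<Rightarrow> 'a set \<Rightarrow> bool" where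
  "closed_ideal A I \<longleftrightarrow>
     closed_subspace A I \<and>
     (\<forall>a\<in>carrier A. \<forall>x\<in>I. a \<otimes>\<^bsub>A\<^esub> x \<in> I \<and> x \<otimes>\<^bsub>A\<^esub> a \<in> I)"

definition ideal_gen :: "('a, 'm) cstar_scheme \<Rightarrow> 'a set \<Rightarrow> 'a set" where
  "ideal_gen A C = closed_ideal A hull C"

text \<open>The elements of the quotient are the cosets of \<open>I\<close>, with the quotient norm.\<close>

definition quot :: "'a cstar \<Rightarrow> 'a set \<Rightarrow> 'a set cstar" where
  "quot A I =
     \<lparr>carrier = a_rcosets\<^bsub>A\<^esub> I,
      monoid.mult = rcoset_mult A I,
      monoid.one = I +>\<^bsub>A\<^esub> \<one>\<^bsub>A\<^esub>,
      ring.zero = I,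
      add = set_add A,
      module.smult = (\<lambda>c S. \<Union>x\<in>S. I +>\<^bsub>A\<^esub> (c \<odot>\<^bsub>A\<^esub> x)),
      adj = (\<lambda>S. \<Union>x\<in>S. I +>\<^bsub>A\<^esub> adj A x),
      cnorm = (\<lambda>S. Inf (cnorm A ` S))\<rparr>"

text \<open>
  The canonical map sends a coset \<open>I + x\<close> to the coset \<open>J + x\<close>. It is the map of quotients
  induced by an inclusion of an ideal (then \<open>I = J\<close>) or by the identity (then \<open>I \<subseteq> J\<close>).
\<close>

definition induced :: "'a cstar \<Rightarrow> 'a set \<Rightarrow> 'a set \<Rightarrow> 'a set" where
  "induced A J S = (\<Union>x\<in>S. J +>\<^bsub>A\<^esub> x)"

text \<open>Exactness of \<open>0 \<rightarrow> A \<rightarrow> B \<rightarrow> C \<rightarrow> 0\<close> at each of the three middle terms.\<close>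

definition short_exact ::
  "'a cstar \<Rightarrow> ('a \<Rightarrow> 'b) \<Rightarrow> 'b cstar \<Rightarrow> ('b \<Rightarrow> 'c) \<Rightarrow> 'c cstar \<Rightarrow> bool" where
  "short_exact A f B g C \<longleftrightarrow>
     star_hom A B f \<and> star_hom B C g \<and>
     {x \<in> carrier A. f x = \<zero>\<^bsub>B\<^esub>} = {\<zero>\<^bsub>A\<^esub>} \<and>
     f ` carrier A = {y \<in> carrier B. g y = \<zero>\<^bsub>C\<^esub>} \<and>
     g ` carrier B = carrier C"


section \<open>Higher-rank graphs\<close>

text \<open>
  Elements of \<open>\<nat>\<^sup>k\<close> are functions on \<open>nat\<close> that vanish outside \<open>{1..k}\<close>.
\<close>

definition degrees :: "nat \<Rightarrow> (nat \<Rightarrow> nat) set" where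
  "degrees k = {m. \<forall>i. i \<notin> {1..k} \<longrightarrow> m i = 0}"

definition unit_deg :: "nat \<Rightarrow> nat \<Rightarrow> nat" where
  "unit_deg i = (\<lambda>j. if j = i then 1 else 0)"

text \<open>
  The category is presented by its morphisms only: an object is identified with its identity
  morphism, so range and source of a morphism are identity morphisms. The composite
  \<open>cmp \<Lambda> \<alpha> \<mu>\<close> is meaningful if \<open>src \<Lambda> \<alpha> = rng \<Lambda> \<mu>\<close>.
\<close>

record 'l graph =
  mor :: "'l set"
  rng :: "'l \<Rightarrow> 'l"
  src :: "'l \<Rightarrow> 'l"
  cmp :: "'l \<Rightarrow> 'l \<Rightarrow> 'l"
  deg :: "'l \<Rightarrow> nat \<Rightarrow> nat"

locale k_graph =
  fixes k :: nat and \<Lambda> :: "'l graph"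
  assumes k_pos: "k \<ge> 1"
    and countable_mor: "countable (mor \<Lambda>)"
    and rng_closed: "\<alpha> \<in> mor \<Lambda> \<Longrightarrow> rng \<Lambda> \<alpha> \<in> mor \<Lambda>"
    and src_closed: "\<alpha> \<in> mor \<Lambda> \<Longrightarrow> src \<Lambda> \<alpha> \<in> mor \<Lambda>"
    and rng_rng: "\<alpha> \<in> mor \<Lambda> \<Longrightarrow> rng \<Lambda> (rng \<Lambda> \<alpha>) = rng \<Lambda> \<alpha>"
    and src_rng: "\<alpha> \<in> mor \<Lambda> \<Longrightarrow> src \<Lambda> (rng \<Lambda> \<alpha>) = rng \<Lambda> \<alpha>"
    and rng_src: "\<alpha> \<in> mor \<Lambda> \<Longrightarrow> rng \<Lambda> (src \<Lambda> \<alpha>) = src \<Lambda> \<alpha>"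
    and src_src: "\<alpha> \<in> mor \<Lambda> \<Longrightarrow> src \<Lambda> (src \<Lambda> \<alpha>) = src \<Lambda> \<alpha>"
    and comp_closed: "\<alpha> \<in> mor \<Lambda> \<Longrightarrow> \<mu> \<in> mor \<Lambda> \<Longrightarrow> src \<Lambda> \<alpha> = rng \<Lambda> \<mu> \<Longrightarrow>
          cmp \<Lambda> \<alpha> \<mu> \<in> mor \<Lambda>"
    and rng_comp: "\<alpha> \<in> mor \<Lambda> \<Longrightarrow> \<mu> \<in> mor \<Lambda> \<Longrightarrow> src \<Lambda> \<alpha> = rng \<Lambda> \<mu> \<Longrightarrow>
          rng \<Lambda> (cmp \<Lambda> \<alpha> \<mu>) = rng \<Lambda> \<alpha>"
    and src_comp: "\<alpha> \<in> mor \<Lambda> \<Longrightarrow> \<mu> \<in> mor \<Lambda> \<Longrightarrow> src \<Lambda> \<alpha> = rng \<Lambda> \<mu> \<Longrightarrow>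
          src \<Lambda> (cmp \<Lambda> \<alpha> \<mu>) = src \<Lambda> \<mu>"
    and comp_rng: "\<alpha> \<in> mor \<Lambda> \<Longrightarrow> cmp \<Lambda> (rng \<Lambda> \<alpha>) \<alpha> = \<alpha>"
    and comp_src: "\<alpha> \<in> mor \<Lambda> \<Longrightarrow> cmp \<Lambda> \<alpha> (src \<Lambda> \<alpha>) = \<alpha>"
    and comp_assoc: "\<alpha> \<in> mor \<Lambda> \<Longrightarrow> \<mu> \<in> mor \<Lambda> \<Longrightarrow> \<nu> \<in> mor \<Lambda> \<Longrightarrow>
          src \<Lambda> \<alpha> = rng \<Lambda> \<mu> \<Longrightarrow> src \<Lambda> \<mu> = rng \<Lambda> \<nu> \<Longrightarrow>
          cmp \<Lambda> (cmp \<Lambda> \<alpha> \<mu>) \<nu> = cmp \<Lambda> \<alpha> (cmp \<Lambda> \<mu> \<nu>)"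
    and deg_closed: "\<alpha> \<in> mor \<Lambda> \<Longrightarrow> deg \<Lambda> \<alpha> \<in> degrees k"
    and deg_rng: "\<alpha> \<in> mor \<Lambda> \<Longrightarrow> deg \<Lambda> (rng \<Lambda> \<alpha>) = (\<lambda>_. 0)"
    and deg_src: "\<alpha> \<in> mor \<Lambda> \<Longrightarrow> deg \<Lambda> (src \<Lambda> \<alpha>) = (\<lambda>_. 0)"
    and deg_comp: "\<alpha> \<in> mor \<Lambda> \<Longrightarrow> \<mu> \<in> mor \<Lambda> \<Longrightarrow> src \<Lambda> \<alpha> = rng \<Lambda> \<mu> \<Longrightarrow>
          deg \<Lambda> (cmp \<Lambda> \<alpha> \<mu>) = (\<lambda>i. deg \<Lambda> \<alpha> i + deg \<Lambda> \<mu> i)"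
    and factorization: "\<alpha> \<in> mor \<Lambda> \<Longrightarrow> m \<in> degrees k \<Longrightarrow> n \<in> degrees k \<Longrightarrow>
          deg \<Lambda> \<alpha> = (\<lambda>i. m i + n i) \<Longrightarrow>
          \<exists>!(\<mu>, \<nu>). \<mu> \<in> mor \<Lambda> \<and> \<nu> \<in> mor \<Lambda> \<and> src \<Lambda> \<mu> = rng \<Lambda> \<nu> \<and>
            \<alpha> = cmp \<Lambda> \<mu> \<nu> \<and> deg \<Lambda> \<mu> = m \<and> deg \<Lambda> \<nu> = n"

definition paths :: "'l graph \<Rightarrow> (nat \<Rightarrow> nat) \<Rightarrow> 'l set" where
  "paths \<Lambda> n = {\<alpha> \<in> mor \<Lambda>. deg \<Lambda> \<alpha> = n}"

text \<open>By unique factorization, the identity morphisms are exactly the morphisms of degree 0.\<close>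

definition vertices :: "'l graph \<Rightarrow> 'l set" where
  "vertices \<Lambda> = paths \<Lambda> (\<lambda>_. 0)"

definition paths_to :: "'l graph \<Rightarrow> 'l \<Rightarrow> (nat \<Rightarrow> nat) \<Rightarrow> 'l set" where
  "paths_to \<Lambda> v n = {\<alpha> \<in> paths \<Lambda> n. rng \<Lambda> \<alpha> = v}"

definition row_finite :: "nat \<Rightarrow> 'l graph \<Rightarrow> bool" where
  "row_finite k \<Lambda> \<longleftrightarrow> (\<forall>v\<in>vertices \<Lambda>. \<forall>i\<in>{1..k}. finite (paths_to \<Lambda> v (unit_deg i)))"

definition no_sources :: "nat \<Rightarrow> 'l graph \<Rightarrow> bool" where
  "no_sources k \<Lambda> \<longleftrightarrow> (\<forall>v\<in>vertices \<Lambda>. \<forall>m\<in>degrees k. paths_to \<Lambda> v m \<noteq> {})"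

definition min_ext :: "'l graph \<Rightarrow> 'l \<Rightarrow> 'l \<Rightarrow> ('l \<times> 'l) set" where
  "min_ext \<Lambda> \<alpha> \<mu> =
     {(\<alpha>', \<mu>'). \<alpha>' \<in> mor \<Lambda> \<and> \<mu>' \<in> mor \<Lambda> \<and>
        src \<Lambda> \<alpha> = rng \<Lambda> \<alpha>' \<and> src \<Lambda> \<mu> = rng \<Lambda> \<mu>' \<and>
        cmp \<Lambda> \<alpha> \<alpha>' = cmp \<Lambda> \<mu> \<mu>' \<and>
        deg \<Lambda> (cmp \<Lambda> \<alpha> \<alpha>') = (\<lambda>i. max (deg \<Lambda> \<alpha> i) (deg \<Lambda> \<mu> i))}"


section \<open>Toeplitz-Cuntz-Krieger families\<close>

text \<open>The sum in the last clause is finite whenever \<open>\<Lambda>\<close> is row-finite.\<close>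

definition TCK_family :: "'l graph \<Rightarrow> ('a, 'm) cstar_scheme \<Rightarrow> ('l \<Rightarrow> 'a) \<Rightarrow> bool" where
  "TCK_family \<Lambda> A T \<longleftrightarrow>
     T ` mor \<Lambda> \<subseteq> carrier A \<and>
     (\<forall>\<alpha>\<in>mor \<Lambda>. T \<alpha> \<otimes>\<^bsub>A\<^esub> adj A (T \<alpha>) \<otimes>\<^bsub>A\<^esub> T \<alpha> = T \<alpha>) \<and>
     (\<forall>v\<in>vertices \<Lambda>. adj A (T v) = T v \<and> T v \<otimes>\<^bsub>A\<^esub> T v = T v) \<and>
     (\<forall>v\<in>vertices \<Lambda>. \<forall>w\<in>vertices \<Lambda>. v \<noteq> w \<longrightarrow> T v \<otimes>\<^bsub>A\<^esub> T w = \<zero>\<^bsub>A\<^esub>) \<and>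
     (\<forall>\<alpha>\<in>mor \<Lambda>. \<forall>\<mu>\<in>mor \<Lambda>. src \<Lambda> \<alpha> = rng \<Lambda> \<mu> \<longrightarrow> T \<alpha> \<otimes>\<^bsub>A\<^esub> T \<mu> = T (cmp \<Lambda> \<alpha> \<mu>)) \<and>
     (\<forall>\<alpha>\<in>mor \<Lambda>. \<forall>\<mu>\<in>mor \<Lambda>.
        adj A (T \<alpha>) \<otimes>\<^bsub>A\<^esub> T \<mu> =
          (\<Oplus>\<^bsub>A\<^esub>p\<in>min_ext \<Lambda> \<alpha> \<mu>. T (fst p) \<otimes>\<^bsub>A\<^esub> adj A (T (snd p))))"

text \<open>
  Universality has to be tested against all C*-algebras \<open>B\<close>, over which one cannot quantify in
  HOL. It suffices that \<open>B\<close> ranges over the C*-algebras whose elements have type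
  \<open>nat \<Rightarrow> real\<close>. Indeed the image of a family lies in the C*-algebra it generates. Since
  \<open>\<Lambda>\<close> is countable, that C*-algebra has a dense sequence \<open>d\<close>, and so it is isomorphic to one
  with elements of type \<open>nat \<Rightarrow> real\<close>, by transport along the injection that sends \<open>x\<close> to the
  sequence of distances from \<open>x\<close> to \<open>d n\<close>. The homomorphism is unique because \<open>t\<close>
  generates \<open>A\<close>.
\<close>

definition universal_TCK :: "'l graph \<Rightarrow> 'a cstar \<Rightarrow> ('l \<Rightarrow> 'a) \<Rightarrow> bool" where
  "universal_TCK \<Lambda> A t \<longleftrightarrow>
     cstar_algebra A \<and> TCK_family \<Lambda> A t \<and>
     cstar_subalgebra A hull (t ` mor \<Lambda>) = carrier A \<and>
     (\<forall>(B :: (nat \<Rightarrow> real) cstar) T. cstar_algebra B \<and> TCK_family \<Lambda> B T \<longrightarrow>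
        (\<exists>\<pi>. star_hom A B \<pi> \<and> (\<forall>\<alpha>\<in>mor \<Lambda>. \<pi> (t \<alpha>) = T \<alpha>)))"

definition gap :: "'l graph \<Rightarrow> 'a cstar \<Rightarrow> ('l \<Rightarrow> 'a) \<Rightarrow> 'l \<Rightarrow> nat \<Rightarrow> 'a" where
  "gap \<Lambda> A t v i =
     t v \<ominus>\<^bsub>A\<^esub> (\<Oplus>\<^bsub>A\<^esub>e\<in>paths_to \<Lambda> v (unit_deg i). t e \<otimes>\<^bsub>A\<^esub> adj A (t e))"

text \<open>
  A product over a finite nonempty index set, taken in increasing order of the indices. In the
  products below the factors commute, so the order is irrelevant. Starting from the first factor
  avoids the need for a unit.
\<close>

definition ordered_prod :: "'a cstar \<Rightarrow> (nat \<Rightarrow> 'a) \<Rightarrow> nat set \<Rightarrow> 'a" where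
  "ordered_prod A f K =
     foldl (\<lambda>x i. x \<otimes>\<^bsub>A\<^esub> f i) (f (Min K)) (sorted_list_of_set (K - {Min K}))"

definition gap_products :: "'l graph \<Rightarrow> 'a cstar \<Rightarrow> ('l \<Rightarrow> 'a) \<Rightarrow> nat set \<Rightarrow> 'a set" where
  "gap_products \<Lambda> A t K = {ordered_prod A (gap \<Lambda> A t v) K | v. v \<in> vertices \<Lambda>}"

end

theory Submission
  imports Defs
begin

text \<open>
  Everything reduces to \<open>\<langle>A\<rangle> \<inter> \<langle>B\<rangle> = \<langle>AB\<rangle>\<close> and \<open>\<langle>A \<union> B\<rangle> = \<langle>A\<rangle> + \<langle>B\<rangle>\<close>. In a C*-algebra both
  \<open>I \<inter> J \<subseteq> \<close> closure of \<open>IJ\<close> and the closedness of \<open>I + J\<close> follow once every \<open>a \<in> I\<close> has, up to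
  \<open>\<epsilon>\<close>, a left unit \<open>e \<in> I\<close> of norm at most 2. Such units are obtained without spectral theory: for
  small self-adjoint \<open>x\<close>, the equation \<open>2c = x\<^sup>2 + c\<^sup>2\<close> is solved by iterating a contraction, so
  that \<open>u = 1 - (c + \<i>x)\<close> is a formal unitary, and \<open>e = 1 - (1 + u + \<dots> + u\<^sup>n\<^sup>-\<^sup>1) / n\<close> lies in the
  algebra and satisfies \<open>(1 - e)(1 - u) = (1 - u\<^sup>n) / n\<close>.

  It remains to see \<open>\<langle>A\<rangle>\<langle>B\<rangle> \<subseteq> \<langle>AB\<rangle>\<close>. The algebra is the closed span of the elements
  \<open>t\<^sub>\<mu> t\<^sub>\<nu>\<^sup>*\<close>, and a factor \<open>t\<^sub>v - \<Sum> t\<^sub>e t\<^sub>e\<^sup>*\<close> either annihilates \<open>t\<^sub>\<mu>\<close> or satisfies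
  \<open>(t\<^sub>v - \<Sum> t\<^sub>e t\<^sub>e\<^sup>*) t\<^sub>\<mu> = t\<^sub>\<mu> (t\<^sub>w - \<Sum> t\<^sub>e t\<^sub>e\<^sup>*)\<close> with \<open>w = s(\<mu>)\<close>. So \<open>a t\<^sub>\<mu> t\<^sub>\<nu>\<^sup>* b\<close> is zero or of
  the form \<open>t\<^sub>\<mu> a' b' t\<^sub>\<nu>\<^sup>*\<close> with \<open>a' \<in> A\<close> and \<open>b' \<in> B\<close>.
\<close>

section \<open>Approximate units in C*-algebras\<close>

context cstar_algebra begin

section \<open>Arithmetic in a C*-algebra without unit\<close>

lemma scalar_carrier [simp]: "c \<in> carrier (ring_of_type_algebra :: complex ring)"
  by (simp add: ring_of_type_algebra_def)

lemma scale_add_left: "x \<in> carrier A \<Longrightarrow> (c + d :: complex) \<odot> x = c \<odot> x \<oplus> d \<odot> x"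
  using smult_l_distr[of c d x] by (simp add: ring_of_type_algebra_def)

lemma scale_add_right: "x \<in> carrier A \<Longrightarrow> y \<in> carrier A \<Longrightarrow> (c :: complex) \<odot> (x \<oplus> y) = c \<odot> x \<oplus> c \<odot> y"
  by (simp add: smult_r_distr)

lemma scale_scale: "x \<in> carrier A \<Longrightarrow> (c::complex) \<odot> (d \<odot> x) = (c * d) \<odot> x"
  using smult_assoc1[of c d x] by (simp add: ring_of_type_algebra_def)

lemma scale_one [simp]: "x \<in> carrier A \<Longrightarrow> (1::complex) \<odot> x = x"
  using smult_one[of x] by (simp add: ring_of_type_algebra_def)

lemma scale_zero_left [simp]: "x \<in> carrier A \<Longrightarrow> (0::complex) \<odot> x = \<zero>"
  using smult_l_null[of x] by (simp add: ring_of_type_algebra_def)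

lemma minus_eq_scale: "x \<in> carrier A \<Longrightarrow> \<ominus> x = (-1::complex) \<odot> x"
proof -
  assume x: "x \<in> carrier A"
  have "(-1::complex) \<odot> x \<oplus> x = ((-1) + 1 :: complex) \<odot> x"
    using x by (simp only: scale_add_left scale_one)
  also have "\<dots> = \<zero>" using x by simp
  finally show ?thesis using x by (intro M.minus_equality) auto
qed

lemma diff_eq_scale: "x \<in> carrier A \<Longrightarrow> y \<in> carrier A \<Longrightarrow> x \<ominus> y = x \<oplus> (-1::complex) \<odot> y"
  by (simp add: a_minus_def minus_eq_scale)

lemma mult_zero_left [simp]: "x \<in> carrier A \<Longrightarrow> \<zero> \<otimes> x = \<zero>"
  using smult_mult_left[of x x 0] by (simp add: mult_closed)

lemma mult_zero_right [simp]: "x \<in> carrier A \<Longrightarrow> x \<otimes> \<zero> = \<zero>"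
  using smult_mult_right[of x x 0] by (simp add: mult_closed)

lemma adj_zero [simp]: "adj A \<zero> = \<zero>"
  using adj_smult[of \<zero> 0] by (simp add: adj_closed)

lemma cnorm_zero [simp]: "cnorm A \<zero> = 0"
  by (simp add: cnorm_eq_0)

declare mult_closed [simp, intro] adj_closed [simp, intro] adj_adj [simp]

text \<open>Normal form for identities: differences become multiples by \<open>-1\<close>, products
  are distributed and associated to the right. After sorting with \<open>M.a_ac\<close>,
  \<open>scale_combine\<close> collects equal summands.\<close>

lemmas expand_simps = diff_eq_scale distrib_left distrib_right mult_assoc smult_mult_left smult_mult_right
  adj_add adj_smult adj_mult scale_add_right scale_scale

lemma scale_combine:
  "x \<in> carrier A \<Longrightarrow> c \<odot> x \<oplus> d \<odot> x = (c + d :: complex) \<odot> x"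
  "x \<in> carrier A \<Longrightarrow> x \<oplus> d \<odot> x = (1 + d :: complex) \<odot> x"
  "x \<in> carrier A \<Longrightarrow> c \<odot> x \<oplus> x = (c + 1 :: complex) \<odot> x"
  "x \<in> carrier A \<Longrightarrow> y \<in> carrier A \<Longrightarrow> c \<odot> x \<oplus> (d \<odot> x \<oplus> y) = (c + d :: complex) \<odot> x \<oplus> y"
  "x \<in> carrier A \<Longrightarrow> y \<in> carrier A \<Longrightarrow> x \<oplus> (d \<odot> x \<oplus> y) = (1 + d :: complex) \<odot> x \<oplus> y"
  "x \<in> carrier A \<Longrightarrow> y \<in> carrier A \<Longrightarrow> c \<odot> x \<oplus> (x \<oplus> y) = (c + 1 :: complex) \<odot> x \<oplus> y"
  by (simp_all add: scale_add_left M.a_assoc)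

text \<open>Sorting can leave one foreign summand between two multiples of \<open>x\<close>; this
  rule collects across it.\<close>

lemma scale_gap:
  assumes "x \<in> carrier A" "y \<in> carrier A"
  shows "x \<oplus> (y \<oplus> c \<odot> x) = (1 + c :: complex) \<odot> x \<oplus> y"
  using assms by (simp_all add: scale_add_left M.a_ac)

lemma diff_add_cancel: "x \<in> carrier A \<Longrightarrow> y \<in> carrier A \<Longrightarrow> (x \<ominus> y) \<oplus> y = x"
  by (simp add: expand_simps M.a_ac scale_combine)

lemma diff_swap: "x \<in> carrier A \<Longrightarrow> y \<in> carrier A \<Longrightarrow> cnorm A (x \<ominus> y) = cnorm A (y \<ominus> x)"
proof -
  assume *: "x \<in> carrier A" "y \<in> carrier A"
  have "x \<ominus> y = (-1) \<odot> (y \<ominus> x)" using * by (simp add: expand_simps M.a_ac)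
  then show ?thesis using * by (simp add: cnorm_smult)
qed

lemma diff_triangle:
  assumes "x \<in> carrier A" "y \<in> carrier A" "z \<in> carrier A"
  shows "cnorm A (x \<ominus> z) \<le> cnorm A (x \<ominus> y) + cnorm A (y \<ominus> z)"
proof -
  have "x \<ominus> z = (x \<ominus> y) \<oplus> (y \<ominus> z)" using assms by (simp add: expand_simps M.a_ac scale_combine)
  then show ?thesis using assms by (simp add: cnorm_triangle)
qed

text \<open>The hypothesis says that \<open>1 - d\<close> is a formal isometry: \<open>(1 - d)\<^sup>* (1 - d) = 1\<close>.\<close>

lemma isometry_step:
  assumes d: "d \<in> carrier A" "adj A d \<otimes> d = adj A d \<oplus> d" and z: "z \<in> carrier A"
  shows "cnorm A (z \<ominus> d \<otimes> z) = cnorm A z"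
proof -
  have "adj A d \<otimes> (d \<otimes> z) = adj A d \<otimes> z \<oplus> d \<otimes> z"
    using d z by (simp add: mult_assoc[symmetric] distrib_right)
  then have "adj A (z \<ominus> d \<otimes> z) \<otimes> (z \<ominus> d \<otimes> z) = adj A z \<otimes> z"
    using d z by (simp add: expand_simps M.a_ac scale_combine)
  then have "(cnorm A (z \<ominus> d \<otimes> z))\<^sup>2 = (cnorm A z)\<^sup>2"
    using cstar_identity[of "z \<ominus> d \<otimes> z"] cstar_identity[of z] d z by simp
  then show ?thesis using cnorm_nonneg d z by (simp add: power2_eq_iff_nonneg)
qed


text \<open>The C*-identity and submultiplicativity bound the norm of \<open>y\<close> by that of
  its adjoint; applying this to \<open>adj A x\<close> as well gives equality.\<close>

lemma cnorm_adj: "x \<in> carrier A \<Longrightarrow> cnorm A (adj A x) = cnorm A x"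
proof -
  have *: "cnorm A y \<le> cnorm A (adj A y)" if y: "y \<in> carrier A" for y
  proof (cases "cnorm A y = 0")
    case False
    have "(cnorm A y)\<^sup>2 \<le> cnorm A (adj A y) * cnorm A y"
      using cstar_identity[OF y] cnorm_mult[of "adj A y" y] y by simp
    then show ?thesis using False cnorm_nonneg[OF y] by (simp add: power2_eq_square)
  qed (use y cnorm_nonneg in simp)
  assume x: "x \<in> carrier A"
  show ?thesis using *[OF x] *[of "adj A x"] x by simp
qed

section \<open>Limits and norm-closed sets\<close>

lemma cnorm_diff_le: "x \<in> carrier A \<Longrightarrow> y \<in> carrier A \<Longrightarrow> cnorm A (x \<ominus> y) \<le> cnorm A x + cnorm A y"
  using cnorm_triangle[of x "(-1) \<odot> y"] by (simp add: diff_eq_scale cnorm_smult)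

lemma diff_zero_iff: "x \<in> carrier A \<Longrightarrow> y \<in> carrier A \<Longrightarrow> x \<ominus> y = \<zero> \<longleftrightarrow> x = y"
  using diff_add_cancel[of x y] by (auto simp: a_minus_def M.r_neg)

text \<open>Completeness enters in this form, for the fixed point iteration and for the closedness
  of sums of ideals.\<close>

lemma geometric_convergent:
  assumes s: "\<And>n. s n \<in> carrier A"
    and step: "\<And>n. cnorm A (s (Suc n) \<ominus> s n) \<le> C * (1/2) ^ n"
  shows "\<exists>x\<in>carrier A. (\<lambda>n. cnorm A (s n \<ominus> x)) \<longlonglongrightarrow> 0"
proof (rule complete)
  show "range s \<subseteq> carrier A" using s by auto
  have C: "C \<ge> 0" using step[of 0] cnorm_nonneg[of "s 1 \<ominus> s 0"] s by simp
  \<comment> \<open>The subtracted term \<open>(1/2) ^ m\<close> lets the telescoping induction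
    close; a bound uniform in \<open>m\<close> is read off afterwards.\<close>
  have tail: "cnorm A (s m \<ominus> s n) \<le> 2 * C * ((1/2) ^ n - (1/2) ^ m)" if "n \<le> m" for m n
    using that
  proof (induction m rule: dec_induct)
    case base
    have "s n \<ominus> s n = \<zero>" using s diff_zero_iff by simp
    then show ?case by simp
  next
    case (step m)
    have "cnorm A (s (Suc m) \<ominus> s n) \<le> cnorm A (s (Suc m) \<ominus> s m) + cnorm A (s m \<ominus> s n)"
      using s by (intro diff_triangle)
    then show ?case using step.IH assms(2)[of m] by (simp add: algebra_simps)
  qed
  show "\<forall>\<epsilon>>0. \<exists>N. \<forall>m\<ge>N. \<forall>n\<ge>N. cnorm A (s m \<ominus> s n) < \<epsilon>"
  proof (intro allI impI)
    fix \<epsilon> :: real assume "\<epsilon> > 0"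
    \<comment> \<open>The added \<open>1\<close> keeps the denominator positive when
      \<open>C = 0\<close>.\<close>
    then obtain N where N: "(1/2::real) ^ N < \<epsilon> / (2 * C + 1)"
      using real_arch_pow_inv[of "\<epsilon> / (2 * C + 1)" "1/2"] C by auto
    have *: "cnorm A (s m \<ominus> s n) < \<epsilon>" if "N \<le> n" "n \<le> m" for m n
    proof -
      have "cnorm A (s m \<ominus> s n) \<le> 2 * C * ((1/2) ^ n - (1/2) ^ m)" by (rule tail[OF that(2)])
      also have "\<dots> \<le> 2 * C * (1/2) ^ N"
        using C power_decreasing[OF that(1), of "1/2::real"] zero_le_power[of "1/2::real" m]
        by (intro mult_left_mono, linarith) simp
      also have "\<dots> \<le> (2 * C + 1) * (1/2) ^ N" by (simp add: algebra_simps)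
      also have "\<dots> < \<epsilon>" using N C by (simp add: field_simps)
      finally show ?thesis .
    qed
    show "\<exists>N. \<forall>m\<ge>N. \<forall>n\<ge>N. cnorm A (s m \<ominus> s n) < \<epsilon>"
    proof (intro exI allI impI)
      fix m n assume "N \<le> m" "N \<le> n"
      then show "cnorm A (s m \<ominus> s n) < \<epsilon>"
        using *[of n m] *[of m n] diff_swap[OF s s, of m n] by (cases "n \<le> m") auto
    qed
  qed
qed

lemma norm_closed_limit:
  assumes "norm_closed A S" "x \<in> carrier A" "\<And>n. s n \<in> S" "\<And>n. s n \<in> carrier A"
    and lim: "(\<lambda>n. cnorm A (s n \<ominus> x)) \<longlonglongrightarrow> 0"
  shows "x \<in> S"
proof -
  have "\<exists>y\<in>S. cnorm A (x \<ominus> y) < \<epsilon>" if "\<epsilon> > 0" for \<epsilon>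
  proof -
    from order_tendstoD(2)[OF lim that] obtain n where "cnorm A (s n \<ominus> x) < \<epsilon>"
      by (auto simp: eventually_sequentially)
    then show ?thesis using assms(2-4) by (intro bexI[of _ "s n"]) (simp_all add: diff_swap[of x])
  qed
  then show ?thesis using assms(1,2) by (simp add: norm_closed_def)
qed

lemma norm_closed_vimage:
  assumes H: "norm_closed A H" and f: "\<And>x. x \<in> carrier A \<Longrightarrow> f x \<in> carrier A"
    and lip: "\<And>x y. x \<in> carrier A \<Longrightarrow> y \<in> carrier A \<Longrightarrow> cnorm A (f x \<ominus> f y) \<le> C * cnorm A (x \<ominus> y)"
  shows "norm_closed A {y \<in> carrier A. f y \<in> H}"
  unfolding norm_closed_def
proof (intro ballI impI)
  fix x assume x: "x \<in> carrier A" and approx: "\<forall>\<epsilon>>0. \<exists>y\<in>{y \<in> carrier A. f y \<in> H}. cnorm A (x \<ominus> y) < \<epsilon>"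
  have "\<exists>z\<in>H. cnorm A (f x \<ominus> z) < \<epsilon>" if "\<epsilon> > 0" for \<epsilon>
  proof -
    \<comment> \<open>\<open>\<bar>C\<bar> + 1\<close> is positive for every real
      \<open>C\<close>.\<close>
    have "\<epsilon> / (\<bar>C\<bar> + 1) > 0" using that by simp
    then obtain y where y: "y \<in> carrier A" "f y \<in> H" "cnorm A (x \<ominus> y) < \<epsilon> / (\<bar>C\<bar> + 1)"
      using approx by blast
    have "cnorm A (f x \<ominus> f y) \<le> C * cnorm A (x \<ominus> y)" by (rule lip[OF x y(1)])
    also have "\<dots> \<le> (\<bar>C\<bar> + 1) * cnorm A (x \<ominus> y)"
      using cnorm_nonneg[of "x \<ominus> y"] x y(1) by (intro mult_right_mono) auto
    also have "\<dots> < \<epsilon>" using y(3) by (simp add: field_simps)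
    finally show ?thesis using y(2) by blast
  qed
  then show "x \<in> {y \<in> carrier A. f y \<in> H}" using H f x by (auto simp: norm_closed_def)
qed

lemma norm_closed_zero: "norm_closed A {\<zero>}"
  unfolding norm_closed_def
proof (intro ballI impI)
  fix x assume x: "x \<in> carrier A" and "\<forall>\<epsilon>>0. \<exists>y\<in>{\<zero>}. cnorm A (x \<ominus> y) < \<epsilon>"
  moreover have "x \<ominus> \<zero> = x" using x by (simp add: diff_eq_scale)
  ultimately have "cnorm A x < \<epsilon>" if "\<epsilon> > 0" for \<epsilon> using that by simp
  then have "cnorm A x = 0" using cnorm_nonneg[OF x] by (metis less_irrefl order_le_less)
  then show "x \<in> {\<zero>}" using x by (simp add: cnorm_eq_0)
qed

text \<open>Lets identities such as self-adjointness pass to limits, once they are written as the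
  vanishing of a bounded additive map.\<close>

lemma norm_closed_kernel:
  assumes f: "\<And>x. x \<in> carrier A \<Longrightarrow> f x \<in> carrier A"
    and diff: "\<And>x y. x \<in> carrier A \<Longrightarrow> y \<in> carrier A \<Longrightarrow> f (x \<ominus> y) = f x \<ominus> f y"
    and bound: "\<And>x. x \<in> carrier A \<Longrightarrow> cnorm A (f x) \<le> C * cnorm A x"
  shows "norm_closed A {y \<in> carrier A. f y = \<zero>}"
  using norm_closed_vimage[OF norm_closed_zero, of f C] f bound by (simp add: diff[symmetric])

section \<open>Local units from formal unitaries\<close>

lemma subalgebra_carrier: "cstar_subalgebra A S \<Longrightarrow> x \<in> S \<Longrightarrow> x \<in> carrier A"
  by (auto simp: cstar_subalgebra_def closed_subspace_def)

text \<open>Formally \<open>c = 1 - sqrt (1 - x^2)\<close>, since the equation says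
  \<open>(1 - c)^2 = 1 - x^2\<close>. The map \<open>F\<close> preserves the ball of radius
  \<open>1/2\<close> and contracts it by the factor \<open>1/2\<close>. Lying in \<open>S\<close>,
  self-adjointness and commuting with \<open>x\<close> hold for all iterates from
  \<open>\<zero>\<close> and survive in the limit.\<close>

lemma sqrt_complement:
  assumes S: "cstar_subalgebra A S" and xS: "x \<in> S" and sa: "adj A x = x" and nx: "cnorm A x \<le> 1/2"
  shows "\<exists>c\<in>S. adj A c = c \<and> c \<otimes> x = x \<otimes> c \<and> x \<otimes> x \<oplus> c \<otimes> c = 2 \<odot> c"
proof -
  define F where "F c = (1/2) \<odot> (x \<otimes> x \<oplus> c \<otimes> c)" for c
  define s where "s n = (F ^^ n) \<zero>" for n
  have x: "x \<in> carrier A" using S xS subalgebra_carrier by blast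
  have F_closed [simp]: "F c \<in> carrier A" if "c \<in> carrier A" for c using that x by (simp add: F_def)
  have lip: "cnorm A (F a \<ominus> F b) \<le> 1/2 * (cnorm A a + cnorm A b) * cnorm A (a \<ominus> b)"
    if ab: "a \<in> carrier A" "b \<in> carrier A" for a b
  proof -
    \<comment> \<open>\<open>a^2 - b^2 = a(a - b) + (a - b)b\<close> holds for noncommuting
      \<open>a\<close> and \<open>b\<close> as well.\<close>
    have "F a \<ominus> F b = (1/2) \<odot> (a \<otimes> (a \<ominus> b) \<oplus> (a \<ominus> b) \<otimes> b)"
      using ab x by (simp add: F_def expand_simps M.a_ac scale_combine)
    moreover have "cnorm A (a \<otimes> (a \<ominus> b) \<oplus> (a \<ominus> b) \<otimes> b)
      \<le> cnorm A a * cnorm A (a \<ominus> b) + cnorm A (a \<ominus> b) * cnorm A b"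
      using ab cnorm_triangle[of "a \<otimes> (a \<ominus> b)" "(a \<ominus> b) \<otimes> b"] cnorm_mult[of a "a \<ominus> b"]
        cnorm_mult[of "a \<ominus> b" b] by simp
    ultimately show ?thesis using ab by (simp add: cnorm_smult algebra_simps)
  qed
  have inv: "s n \<in> S \<and> adj A (s n) = s n \<and> s n \<otimes> x = x \<otimes> s n \<and> cnorm A (s n) \<le> 1/2" for n
  proof (induction n)
    case 0
    show ?case using S x by (simp add: s_def cstar_subalgebra_def closed_subspace_def)
  next
    case (Suc n)
    define c where "c = s n"
    have IH: "c \<in> S" "adj A c = c" "c \<otimes> x = x \<otimes> c" "cnorm A c \<le> 1/2" using Suc by (auto simp: c_def)
    have c: "c \<in> carrier A" using S IH(1) subalgebra_carrier by blast
    have "s (Suc n) = F c" by (simp add: s_def c_def)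
    moreover have "F c \<in> S"
      using S IH(1) xS by (simp add: F_def cstar_subalgebra_def closed_subspace_def)
    moreover have "adj A (F c) = F c" using c x sa IH(2) by (simp add: F_def expand_simps)
    moreover have "F c \<otimes> x = x \<otimes> F c"
    proof -
      have "c \<otimes> (c \<otimes> x) = x \<otimes> (c \<otimes> c)"
        using c x IH(3) by (metis mult_assoc)
      then show ?thesis using c x by (simp add: F_def expand_simps)
    qed
    moreover have "cnorm A (F c) \<le> 1/2"
    proof -
      have "cnorm A (x \<otimes> x) \<le> 1/2 * (1/2)"
        using cnorm_mult[OF x x] nx cnorm_nonneg[OF x] mult_mono[OF nx nx] by simp
      moreover have "cnorm A (c \<otimes> c) \<le> 1/2 * (1/2)"
        using cnorm_mult[OF c c] cnorm_nonneg[OF c] mult_mono[OF IH(4) IH(4)] by simp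
      ultimately show ?thesis
        using cnorm_triangle[of "x \<otimes> x" "c \<otimes> c"] x c by (simp add: F_def cnorm_smult)
    qed
    ultimately show ?case by simp
  qed
  have s: "s n \<in> carrier A" for n using inv S subalgebra_carrier by blast
  have step: "cnorm A (s (Suc n) \<ominus> s n) \<le> 1 * (1/2) ^ n" for n
  proof (induction n)
    case 0
    show ?case using cnorm_diff_le[OF s s, of 1 0] inv[of 1] inv[of 0] by simp
  next
    case (Suc n)
    have "cnorm A (s (Suc (Suc n)) \<ominus> s (Suc n))
        \<le> 1/2 * (cnorm A (s (Suc n)) + cnorm A (s n)) * cnorm A (s (Suc n) \<ominus> s n)"
      using lip[OF s s, of "Suc n" n] by (simp add: s_def)
    also have "\<dots> \<le> 1/2 * 1 * cnorm A (s (Suc n) \<ominus> s n)"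
      using inv[of "Suc n"] inv[of n] cnorm_nonneg[of "s (Suc n) \<ominus> s n"] s
      by (intro mult_right_mono mult_left_mono) auto
    finally show ?case using Suc by simp
  qed
  obtain c where c: "c \<in> carrier A" and lim: "(\<lambda>n. cnorm A (s n \<ominus> c)) \<longlonglongrightarrow> 0"
    using geometric_convergent[OF s step] by blast
  have "c \<in> S"
    using S by (intro norm_closed_limit[OF _ c _ s lim])
      (auto simp: cstar_subalgebra_def closed_subspace_def inv)
  moreover have "c \<in> {y \<in> carrier A. adj A y \<ominus> y = \<zero>}"
  proof (rule norm_closed_limit[OF norm_closed_kernel[of _ 2] c _ s lim])
    fix y assume y: "y \<in> carrier A"
    show "cnorm A (adj A y \<ominus> y) \<le> 2 * cnorm A y"
      using cnorm_diff_le[of "adj A y" y] y by (simp add: cnorm_adj)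
  qed (auto simp: s inv diff_zero_iff, simp add: expand_simps M.a_ac)
  moreover have "c \<in> {y \<in> carrier A. y \<otimes> x \<ominus> x \<otimes> y = \<zero>}"
  proof (rule norm_closed_limit[OF norm_closed_kernel[of _ "2 * cnorm A x"] c _ s lim])
    fix y assume y: "y \<in> carrier A"
    show "cnorm A (y \<otimes> x \<ominus> x \<otimes> y) \<le> 2 * cnorm A x * cnorm A y"
      using cnorm_diff_le[of "y \<otimes> x" "x \<otimes> y"] y x cnorm_mult[of x y] cnorm_mult[of y x]
      by (simp add: mult.commute[of "cnorm A y"])
  qed (use x in \<open>auto simp: s inv diff_zero_iff\<close>, simp add: expand_simps M.a_ac)
  moreover have "x \<otimes> x \<oplus> c \<otimes> c = 2 \<odot> c"
  proof -
    \<comment> \<open>The fixed point equation follows by bounding the defect of \<open>c\<close> by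
      quantities that tend to \<open>0\<close> along the iteration.\<close>
    have "cnorm A (F c \<ominus> c) \<le> 1/2 * (cnorm A c + 1/2) * cnorm A (s n \<ominus> c) + cnorm A (s (Suc n) \<ominus> c)" for n
    proof -
      have "cnorm A (F c \<ominus> c) \<le> cnorm A (F c \<ominus> F (s n)) + cnorm A (F (s n) \<ominus> c)"
        using c s by (intro diff_triangle) auto
      moreover have "cnorm A (F c \<ominus> F (s n)) \<le> 1/2 * (cnorm A c + cnorm A (s n)) * cnorm A (s n \<ominus> c)"
        using lip[OF c s, of n] diff_swap[OF c s, of n] by simp
      moreover have "1/2 * (cnorm A c + cnorm A (s n)) * cnorm A (s n \<ominus> c)
          \<le> 1/2 * (cnorm A c + 1/2) * cnorm A (s n \<ominus> c)"
        using inv[of n] cnorm_nonneg[of "s n \<ominus> c"] s c by (intro mult_right_mono mult_left_mono) auto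
      ultimately show ?thesis by (simp add: s_def)
    qed
    moreover have "(\<lambda>n. 1/2 * (cnorm A c + 1/2) * cnorm A (s n \<ominus> c) + cnorm A (s (Suc n) \<ominus> c)) \<longlonglongrightarrow>
        1/2 * (cnorm A c + 1/2) * 0 + 0"
      by (intro tendsto_intros lim LIMSEQ_Suc[OF lim])
    ultimately have "cnorm A (F c \<ominus> c) \<le> 0"
      by (intro LIMSEQ_le_const) auto
    then have "F c = c" using cnorm_nonneg[of "F c \<ominus> c"] c cnorm_eq_0[of "F c \<ominus> c"] diff_zero_iff by simp
    then have "2 \<odot> F c = 2 \<odot> c" by simp
    then show ?thesis using c x by (simp add: F_def scale_scale)
  qed
  ultimately show ?thesis using c x by (auto simp: diff_zero_iff)
qed


text \<open>The triangle inequality bounds the norm of \<open>w \<otimes> z\<close> by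
  \<open>2 ||z||\<close>; with the adjoint of \<open>w\<close> for \<open>z\<close>, the C*-identity
  turns this into \<open>||w||^2 \<le> 2 ||w||\<close>.\<close>

lemma isometric_bound:
  assumes w: "w \<in> carrier A" and iso: "\<And>z. z \<in> carrier A \<Longrightarrow> cnorm A (z \<ominus> w \<otimes> z) = cnorm A z"
  shows "cnorm A w \<le> 2"
proof (cases "cnorm A w = 0")
  case False
  let ?z = "adj A w"
  have "w \<otimes> ?z = ?z \<ominus> (?z \<ominus> w \<otimes> ?z)" using w by (simp add: expand_simps M.a_ac scale_combine scale_gap)
  then have "cnorm A (w \<otimes> ?z) \<le> cnorm A ?z + cnorm A (?z \<ominus> w \<otimes> ?z)"
    using cnorm_diff_le[of ?z "?z \<ominus> w \<otimes> ?z"] w by simp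
  then have "(cnorm A w)\<^sup>2 \<le> 2 * cnorm A w"
    using cstar_identity[of ?z] w iso[of ?z] by (simp add: cnorm_adj)
  then show ?thesis using False cnorm_nonneg[OF w] by (simp add: power2_eq_square)
qed simp

text \<open>Here \<open>w = 1 - (1 - d)\<^sup>n\<close> and \<open>E = \<Sum>k<n. 1 - (1 - d)\<^sup>k\<close>, written without a unit.\<close>

lemma cesaro_unit:
  assumes S: "cstar_subalgebra A S" and d: "d \<in> S" "adj A d \<otimes> d = adj A d \<oplus> d"
  shows "\<exists>w\<in>S. \<exists>E\<in>S. (\<forall>z\<in>carrier A. cnorm A (z \<ominus> w \<otimes> z) = cnorm A z) \<and>
    cnorm A E \<le> 2 * real n \<and> of_nat n \<odot> d \<ominus> E \<otimes> d = w"
proof (induction n)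
  case 0
  have "d \<in> carrier A" using S d subalgebra_carrier by blast
  then show ?case using S
    by (intro bexI[of _ \<zero>]) (auto simp: cstar_subalgebra_def closed_subspace_def diff_eq_scale)
next
  case (Suc n)
  then obtain w E where wE: "w \<in> S" "E \<in> S" and iso: "\<And>z. z \<in> carrier A \<Longrightarrow> cnorm A (z \<ominus> w \<otimes> z) = cnorm A z"
    and E: "cnorm A E \<le> 2 * real n" and eq: "of_nat n \<odot> d \<ominus> E \<otimes> d = w" by blast
  have car: "w \<in> carrier A" "E \<in> carrier A" "d \<in> carrier A"
    using S wE d subalgebra_carrier by blast+
  have S_closed: "x \<oplus> y \<in> S" "c \<odot> x \<in> S" "x \<otimes> y \<in> S" if "x \<in> S" "y \<in> S" for x y c
    using S that by (auto simp: cstar_subalgebra_def closed_subspace_def)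
  \<comment> \<open>Formally \<open>1 - ?w = (1 - w)(1 - d)\<close>, and the next summand of
    \<open>E\<close> is \<open>w\<close>.\<close>
  let ?w = "w \<oplus> d \<ominus> w \<otimes> d"
  have "?w \<in> S" using wE d car by (simp add: diff_eq_scale S_closed)
  moreover have "E \<oplus> w \<in> S" using wE S_closed by blast
  moreover have "cnorm A (z \<ominus> ?w \<otimes> z) = cnorm A z" if z: "z \<in> carrier A" for z
  proof -
    have "z \<ominus> ?w \<otimes> z = (z \<ominus> d \<otimes> z) \<ominus> w \<otimes> (z \<ominus> d \<otimes> z)"
      using z car by (simp add: expand_simps M.a_ac scale_combine)
    then show ?thesis using iso[of "z \<ominus> d \<otimes> z"] isometry_step[OF car(3) d(2) z] z car by simp
  qed
  moreover have "cnorm A (E \<oplus> w) \<le> 2 * real (Suc n)"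
    using cnorm_triangle[OF car(2,1)] E isometric_bound[OF car(1) iso] by simp
  moreover have "of_nat (Suc n) \<odot> d \<ominus> (E \<oplus> w) \<otimes> d = ?w"
    unfolding eq[symmetric] using car by (simp add: expand_simps M.a_ac scale_combine add.commute)
  ultimately show ?case by blast
qed

text \<open>For a small multiple \<open>y\<close> of \<open>x\<close>, the element \<open>d\<close>
  is chosen so that \<open>1 - d\<close> is a formal unitary. The Cesaro mean \<open>e\<close> makes
  \<open>d - e d\<close> of order \<open>1/n\<close>, and \<open>y\<close> inherits this because it
  is \<open>d\<close> multiplied on the right.\<close>

lemma local_unit_selfadjoint:
  assumes S: "cstar_subalgebra A S" and xS: "x \<in> S" and sa: "adj A x = x" and "\<epsilon> > 0"
  shows "\<exists>e\<in>S. cnorm A e \<le> 2 \<and> cnorm A (x \<ominus> e \<otimes> x) < \<epsilon>"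
proof -
  have S_closed: "u \<oplus> v \<in> S" "c \<odot> u \<in> S" if "u \<in> S" "v \<in> S" for u v c
    using S that by (auto simp: cstar_subalgebra_def closed_subspace_def)
  have x: "x \<in> carrier A" using S xS subalgebra_carrier by blast
  \<comment> \<open>The scaling brings the norm of \<open>y\<close> down to at most
    \<open>1/2\<close>, as \<open>sqrt_complement\<close> demands; the added \<open>1\<close> covers
    \<open>x = \<zero>\<close>.\<close>
  define r where "r = 1 / (2 * (cnorm A x + 1))"
  have r: "r > 0" using cnorm_nonneg[OF x] by (simp add: r_def)
  define y where "y = complex_of_real r \<odot> x"
  have y: "y \<in> carrier A" "y \<in> S" "adj A y = y" using x xS S_closed by (auto simp: y_def adj_smult sa)
  have xy: "x = complex_of_real (1/r) \<odot> y" using x r by (simp add: y_def scale_scale)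
  have "cnorm A y = r * cnorm A x" using x r by (simp add: y_def cnorm_smult)
  also have "\<dots> \<le> 1/2" using cnorm_nonneg[OF x] by (simp add: r_def field_simps)
  finally have "cnorm A y \<le> 1/2" .
  from sqrt_complement[OF S y(2,3) this] obtain c where
    c: "c \<in> S" "adj A c = c" "c \<otimes> y = y \<otimes> c" "y \<otimes> y \<oplus> c \<otimes> c = 2 \<odot> c" by blast
  have cc: "c \<in> carrier A" using S c subalgebra_carrier by blast
  define d where "d = c \<oplus> \<i> \<odot> y"
  have dS: "d \<in> S" using c y S_closed by (simp add: d_def)
  have d: "d \<in> carrier A" using cc y by (simp add: d_def)
  have "c \<oplus> c = 2 \<odot> c" using scale_add_left[OF cc, of 1 1] cc by simp
  then have sum: "adj A d \<oplus> d = 2 \<odot> c"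
    using cc y(1,3) c(2) by (simp add: d_def expand_simps M.a_ac scale_combine)
  have dd: "adj A d \<otimes> d = adj A d \<oplus> d" "d \<otimes> adj A d = adj A d \<oplus> d"
    unfolding sum c(4)[symmetric] using cc y c by (simp_all add: d_def expand_simps M.a_ac scale_combine)
  \<comment> \<open>By \<open>dd\<close>, \<open>2 d\<close> minus \<open>d\<close> times its
    adjoint equals \<open>d\<close> minus its adjoint, which is \<open>2 \<i> y\<close>. Hence
    estimates for left multiplication on \<open>d\<close> carry over to \<open>y\<close>.\<close>
  have y_eq: "y = (-\<i>/2) \<odot> (2 \<odot> d \<ominus> d \<otimes> adj A d)"
    unfolding dd sum using cc y by (simp add: d_def expand_simps M.a_ac scale_combine)
  \<comment> \<open>Chosen so that \<open>||x - e x|| \<le> C / n\<close>: the factor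
    \<open>1/r\<close> undoes the scaling, \<open>2 + cnorm A d\<close> comes from
    \<open>y_eq\<close>, and the factor \<open>1/2\<close> there cancels against
    \<open>||q|| \<le> 2 / n\<close>.\<close>
  define C where "C = (2 + cnorm A d) / r"
  have C: "C > 0" using r cnorm_nonneg[OF d] by (simp add: C_def)
  obtain n :: nat where n: "real n > C / \<epsilon>" using reals_Archimedean2 by blast
  have n0: "n > 0" using n C \<open>\<epsilon> > 0\<close> by (metis divide_pos_pos gr0I less_asym of_nat_0)
  obtain w E where wE: "w \<in> S" "E \<in> S" and iso: "\<And>z. z \<in> carrier A \<Longrightarrow> cnorm A (z \<ominus> w \<otimes> z) = cnorm A z"
    and E: "cnorm A E \<le> 2 * real n" and eq: "of_nat n \<odot> d \<ominus> E \<otimes> d = w"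
    using cesaro_unit[OF S dS dd(1), of n] by blast
  have car: "w \<in> carrier A" "E \<in> carrier A" using S wE subalgebra_carrier by blast+
  define e where "e = complex_of_real (1 / real n) \<odot> E"
  have e: "e \<in> carrier A" "e \<in> S" using car wE S_closed by (auto simp: e_def)
  have "cnorm A e \<le> 2" using E n0 car by (simp add: e_def cnorm_smult norm_divide field_simps)
  moreover have "cnorm A (x \<ominus> e \<otimes> x) < \<epsilon>"
  proof -
    define q where "q = d \<ominus> e \<otimes> d"
    define u where "u = 2 \<odot> q \<ominus> q \<otimes> adj A d"
    have qu: "q \<in> carrier A" "u \<in> carrier A" using d e by (auto simp: q_def u_def)
    have "q = complex_of_real (1 / real n) \<odot> w"
      unfolding eq[symmetric] q_def using car d n0 by (simp add: e_def expand_simps)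
    then have q: "cnorm A q \<le> 2 / real n"
      using isometric_bound[OF car(1) iso] n0 car by (simp add: cnorm_smult norm_divide field_simps)
    have yu: "y \<ominus> e \<otimes> y = (-\<i>/2) \<odot> u"
      by (subst (1 2) y_eq) (use e d in \<open>simp add: u_def q_def expand_simps M.a_ac\<close>)
    have xu: "x \<ominus> e \<otimes> x = complex_of_real (1/r) \<odot> ((-\<i>/2) \<odot> u)"
      unfolding yu[symmetric] by (subst (1 2) xy) (use e y in \<open>simp add: expand_simps M.a_ac\<close>)
    have "cnorm A (x \<ominus> e \<otimes> x) = 1 / r * (1/2 * cnorm A u)"
      unfolding xu using qu r by (simp add: cnorm_smult norm_divide)
    moreover have "cnorm A u \<le> (2 + cnorm A d) * cnorm A q"
      using cnorm_diff_le[of "2 \<odot> q" "q \<otimes> adj A d"] cnorm_mult[of q "adj A d"] d qu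
      by (simp add: u_def cnorm_smult cnorm_adj algebra_simps)
    ultimately have "cnorm A (x \<ominus> e \<otimes> x) \<le> 1 / r * (1/2 * ((2 + cnorm A d) * cnorm A q))"
      using r by (simp add: divide_right_mono)
    then have "cnorm A (x \<ominus> e \<otimes> x) \<le> C / 2 * cnorm A q" by (simp add: C_def)
    moreover have "C / 2 * cnorm A q \<le> C / 2 * (2 / real n)" using q C by (intro mult_left_mono) auto
    moreover have "C / 2 * (2 / real n) < \<epsilon>" using n n0 \<open>\<epsilon> > 0\<close> by (simp add: field_simps)
    ultimately show ?thesis by linarith
  qed
  ultimately show ?thesis using e(2) by (intro bexI[of _ e] conjI)
qed

text \<open>The self-adjoint case is applied to \<open>?h\<close>. The product of
  \<open>a - e a\<close> with its adjoint is \<open>?q\<close> minus \<open>?q\<close> times the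
  adjoint of \<open>e\<close>, of norm at most \<open>3 ||?q||\<close>; hence the tolerance
  \<open>\<epsilon>\<^sup>2 / 3\<close>.\<close>

lemma local_unit:
  assumes S: "cstar_subalgebra A S" and a: "a \<in> carrier A" "a \<otimes> adj A a \<in> S" and "\<epsilon> > 0"
  shows "\<exists>e\<in>S. cnorm A e \<le> 2 \<and> cnorm A (a \<ominus> e \<otimes> a) < \<epsilon>"
proof -
  let ?h = "a \<otimes> adj A a"
  have "adj A ?h = ?h" "\<epsilon>\<^sup>2 / 3 > 0" using a \<open>\<epsilon> > 0\<close> by (auto simp: adj_mult)
  from local_unit_selfadjoint[OF S a(2) this] obtain e where e: "e \<in> S" "cnorm A e \<le> 2"
    and he: "cnorm A (?h \<ominus> e \<otimes> ?h) < \<epsilon>\<^sup>2 / 3" by blast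
  have ec: "e \<in> carrier A" using S e subalgebra_carrier by blast
  let ?q = "?h \<ominus> e \<otimes> ?h"
  have "(a \<ominus> e \<otimes> a) \<otimes> adj A (a \<ominus> e \<otimes> a) = ?q \<ominus> ?q \<otimes> adj A e"
    using a ec by (simp add: expand_simps M.a_ac)
  then have "(cnorm A (a \<ominus> e \<otimes> a))\<^sup>2 = cnorm A (?q \<ominus> ?q \<otimes> adj A e)"
    using cstar_identity[of "adj A (a \<ominus> e \<otimes> a)"] a ec by (simp add: cnorm_adj)
  also have "\<dots> \<le> cnorm A ?q + cnorm A ?q * cnorm A e"
    using cnorm_diff_le[of ?q "?q \<otimes> adj A e"] cnorm_mult[of ?q "adj A e"] a ec by (simp add: cnorm_adj)
  also have "\<dots> \<le> cnorm A ?q + cnorm A ?q * 2"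
    using e(2) cnorm_nonneg[of ?q] a ec by (intro add_left_mono mult_left_mono) auto
  also have "\<dots> < \<epsilon>\<^sup>2" using he by simp
  finally have "cnorm A (a \<ominus> e \<otimes> a) < \<epsilon>" using \<open>\<epsilon> > 0\<close> by (simp add: power2_less_imp_less)
  then show ?thesis using e by blast
qed

section \<open>Closed ideals\<close>

lemma closed_idealD:
  assumes "closed_ideal A I"
  shows "I \<subseteq> carrier A" "\<And>x. x \<in> I \<Longrightarrow> x \<in> carrier A" "\<zero> \<in> I"
    "\<And>x y. x \<in> I \<Longrightarrow> y \<in> I \<Longrightarrow> x \<oplus> y \<in> I" "\<And>c x. x \<in> I \<Longrightarrow> c \<odot> x \<in> I"
    "\<And>x y. x \<in> I \<Longrightarrow> y \<in> I \<Longrightarrow> x \<ominus> y \<in> I"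
    "\<And>a x. a \<in> carrier A \<Longrightarrow> x \<in> I \<Longrightarrow> a \<otimes> x \<in> I"
    "\<And>a x. a \<in> carrier A \<Longrightarrow> x \<in> I \<Longrightarrow> x \<otimes> a \<in> I" "norm_closed A I"
proof -
  show 1: "I \<subseteq> carrier A" "\<And>x. x \<in> I \<Longrightarrow> x \<in> carrier A" "\<zero> \<in> I"
    "\<And>x y. x \<in> I \<Longrightarrow> y \<in> I \<Longrightarrow> x \<oplus> y \<in> I" "\<And>c x. x \<in> I \<Longrightarrow> c \<odot> x \<in> I"
    "\<And>a x. a \<in> carrier A \<Longrightarrow> x \<in> I \<Longrightarrow> a \<otimes> x \<in> I"
    "\<And>a x. a \<in> carrier A \<Longrightarrow> x \<in> I \<Longrightarrow> x \<otimes> a \<in> I" "norm_closed A I"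
    using assms by (auto simp: closed_ideal_def closed_subspace_def)
  show "x \<ominus> y \<in> I" if "x \<in> I" "y \<in> I" for x y
    using 1 that by (simp add: diff_eq_scale)
qed

lemma closed_idealI:
  assumes "I \<subseteq> carrier A" "\<zero> \<in> I"
    "\<And>x y. x \<in> I \<Longrightarrow> y \<in> I \<Longrightarrow> x \<oplus> y \<in> I" "\<And>c x. x \<in> I \<Longrightarrow> c \<odot> x \<in> I"
    "\<And>a x. a \<in> carrier A \<Longrightarrow> x \<in> I \<Longrightarrow> a \<otimes> x \<in> I"
    "\<And>a x. a \<in> carrier A \<Longrightarrow> x \<in> I \<Longrightarrow> x \<otimes> a \<in> I" "norm_closed A I"
  shows "closed_ideal A I"
  using assms by (auto simp: closed_ideal_def closed_subspace_def)

text \<open>Self-adjointness of closed ideals is itself proved with local units, so these are first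
  sought in the part of \<open>I\<close> that is stable under adjoints.\<close>

lemma ideal_star_part:
  assumes I: "closed_ideal A I"
  shows "cstar_subalgebra A {y \<in> carrier A. y \<in> I \<and> adj A y \<in> I}"
proof -
  note [simp] = closed_idealD[OF I]
  have "norm_closed A {y \<in> carrier A. adj A y \<in> I}"
  proof (rule norm_closed_vimage[where C = 1])
    fix x y assume "x \<in> carrier A" "y \<in> carrier A"
    moreover from this have "adj A x \<ominus> adj A y = adj A (x \<ominus> y)" by (simp add: expand_simps)
    ultimately show "cnorm A (adj A x \<ominus> adj A y) \<le> 1 * cnorm A (x \<ominus> y)" by (simp add: cnorm_adj)
  qed auto
  then have "norm_closed A {y \<in> carrier A. y \<in> I \<and> adj A y \<in> I}"
    using closed_idealD(9)[OF I] unfolding norm_closed_def by fast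
  then show ?thesis
    by (auto simp: cstar_subalgebra_def closed_subspace_def adj_add adj_smult adj_mult)
qed

text \<open>\<open>a \<otimes> adj A a\<close> is self-adjoint and in \<open>I\<close>, so it lies
  in the star part even before \<open>adj A a \<in> I\<close> is known.\<close>

lemma ideal_local_unit:
  assumes I: "closed_ideal A I" and a: "a \<in> I" and "\<epsilon> > 0"
  shows "\<exists>e\<in>I. adj A e \<in> I \<and> cnorm A e \<le> 2 \<and> cnorm A (a \<ominus> e \<otimes> a) < \<epsilon>"
  using local_unit[OF ideal_star_part[OF I], of a \<epsilon>] closed_idealD[OF I] a \<open>\<epsilon> > 0\<close>
  by (auto simp: adj_mult)

text \<open>If \<open>e \<otimes> a\<close> is close to \<open>a\<close>, then
  \<open>adj A a \<otimes> adj A e\<close> is close to \<open>adj A a\<close>, and it lies in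
  \<open>I\<close> because \<open>adj A e\<close> does.\<close>

lemma ideal_adj:
  assumes I: "closed_ideal A I" and a: "a \<in> I"
  shows "adj A a \<in> I"
proof -
  have ac: "a \<in> carrier A" using closed_idealD(2)[OF I a] .
  have "\<exists>y\<in>I. cnorm A (adj A a \<ominus> y) < \<epsilon>" if "\<epsilon> > 0" for \<epsilon>
  proof -
    from ideal_local_unit[OF I a that] obtain e where
      e: "e \<in> I" "adj A e \<in> I" "cnorm A (a \<ominus> e \<otimes> a) < \<epsilon>" by blast
    have ec: "e \<in> carrier A" using closed_idealD(2)[OF I e(1)] .
    have "adj A a \<ominus> adj A a \<otimes> adj A e = adj A (a \<ominus> e \<otimes> a)" using ac ec by (simp add: expand_simps)
    then have "cnorm A (adj A a \<ominus> adj A a \<otimes> adj A e) < \<epsilon>" using e ac ec by (simp add: cnorm_adj)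
    moreover have "adj A a \<otimes> adj A e \<in> I" using e ac closed_idealD(7)[OF I] by simp
    ultimately show ?thesis by blast
  qed
  then show ?thesis using closed_idealD(9)[OF I] ac by (simp add: norm_closed_def)
qed

text \<open>An \<open>x\<close> in the intersection is a limit of elements
  \<open>e \<otimes> x\<close> with \<open>e \<in> I\<close>, and \<open>mult\<close> places these
  in \<open>H\<close>.\<close>

lemma ideal_Int_subset:
  assumes I: "closed_ideal A I" and J: "J \<subseteq> carrier A" and H: "norm_closed A H"
    and mult: "\<And>x y. x \<in> I \<Longrightarrow> y \<in> J \<Longrightarrow> x \<otimes> y \<in> H"
  shows "I \<inter> J \<subseteq> H"
proof
  fix x assume x: "x \<in> I \<inter> J"
  have "\<exists>y\<in>H. cnorm A (x \<ominus> y) < \<epsilon>" if "\<epsilon> > 0" for \<epsilon>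
    using ideal_local_unit[OF I _ that, of x] mult x by blast
  then show "x \<in> H" using H J x by (auto simp: norm_closed_def)
qed

text \<open>A decomposition can be changed so that its \<open>I\<close>-part is controlled by the
  sum. This makes it possible to choose convergent decompositions for a convergent sequence of
  sums.\<close>

lemma ideal_split:
  assumes I: "closed_ideal A I" and J: "closed_ideal A J" and a: "a \<in> I" and b: "b \<in> J" and "\<epsilon> > 0"
  shows "\<exists>a'\<in>I. \<exists>b'\<in>J. a' \<oplus> b' = a \<oplus> b \<and> cnorm A a' \<le> 2 * cnorm A (a \<oplus> b) + \<epsilon>"
proof -
  obtain e where e: "e \<in> I" "cnorm A e \<le> 2" "cnorm A (a \<ominus> e \<otimes> a) < \<epsilon>"
    using ideal_local_unit[OF I a \<open>\<epsilon> > 0\<close>] by blast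
  have car: "a \<in> carrier A" "b \<in> carrier A" "e \<in> carrier A"
    using closed_idealD(2)[OF I] closed_idealD(2)[OF J] a b e by auto
  \<comment> \<open>\<open>a + eb = e(a + b) + (a - ea)\<close> is controlled by \<open>a + b\<close>\<close>
  have "a \<oplus> e \<otimes> b \<in> I" "b \<ominus> e \<otimes> b \<in> J"
    using a b e car closed_idealD(4,8)[OF I] closed_idealD(6,7)[OF J] by auto
  moreover have "(a \<oplus> e \<otimes> b) \<oplus> (b \<ominus> e \<otimes> b) = a \<oplus> b"
    using car by (simp add: expand_simps M.a_ac scale_combine)
  moreover have "cnorm A (a \<oplus> e \<otimes> b) \<le> 2 * cnorm A (a \<oplus> b) + \<epsilon>"
  proof -
    have "a \<oplus> e \<otimes> b = e \<otimes> (a \<oplus> b) \<oplus> (a \<ominus> e \<otimes> a)"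
      using car by (simp add: expand_simps M.a_ac scale_combine scale_gap)
    then have "cnorm A (a \<oplus> e \<otimes> b) \<le> cnorm A (e \<otimes> (a \<oplus> b)) + cnorm A (a \<ominus> e \<otimes> a)"
      using car by (simp add: cnorm_triangle)
    also have "\<dots> \<le> 2 * cnorm A (a \<oplus> b) + \<epsilon>"
      using cnorm_mult[of e "a \<oplus> b"] mult_right_mono[OF e(2), of "cnorm A (a \<oplus> b)"] cnorm_nonneg e(3) car
      by (intro add_mono) (auto intro: order_trans)
    finally show ?thesis .
  qed
  ultimately show ?thesis by blast
qed

text \<open>Expresses the error of the \<open>J\<close>-part through the error of the
  \<open>I\<close>-part and the error of the whole sum.\<close>

lemma diff_regroup:
  "a \<in> carrier A \<Longrightarrow> b \<in> carrier A \<Longrightarrow> f \<in> carrier A \<Longrightarrow> x \<in> carrier A \<Longrightarrow>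
    b \<ominus> (x \<ominus> a) = (-1) \<odot> ((f \<ominus> a) \<oplus> (x \<ominus> (f \<oplus> b)))"
  by (simp add: expand_simps M.a_ac scale_combine scale_gap)

text \<open>Decompositions of approximants to \<open>x\<close> are corrected by
  \<open>ideal_split\<close> so that their \<open>I\<close>-parts converge geometrically to some
  \<open>a\<close> in \<open>I\<close>; the \<open>J\<close>-parts then converge to
  \<open>x \<ominus> a\<close>.\<close>

lemma ideal_sum_norm_closed:
  assumes I: "closed_ideal A I" and J: "closed_ideal A J"
  shows "norm_closed A {a \<oplus> b | a b. a \<in> I \<and> b \<in> J}"
  unfolding norm_closed_def
proof (intro ballI impI)
  fix x assume x: "x \<in> carrier A"
    and "\<forall>\<epsilon>>0. \<exists>y\<in>{a \<oplus> b | a b. a \<in> I \<and> b \<in> J}. cnorm A (x \<ominus> y) < \<epsilon>"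
  then have approx: "\<exists>a\<in>I. \<exists>b\<in>J. cnorm A (x \<ominus> (a \<oplus> b)) < \<epsilon>" if "\<epsilon> > 0" for \<epsilon>
    using that by blast
  note IJ_car = closed_idealD(2)[OF I] closed_idealD(2)[OF J]
  define P where "P n p \<longleftrightarrow> fst p \<in> I \<and> snd p \<in> J \<and> cnorm A (x \<ominus> (fst p \<oplus> snd p)) < (1/2) ^ n"
    for n :: nat and p
  have "\<exists>f. \<forall>n. P n (f n) \<and> cnorm A (fst (f (Suc n)) \<ominus> fst (f n)) \<le> 4 * (1/2) ^ n"
  proof (rule dependent_nat_choice)
    show "\<exists>p. P 0 p" using approx[of 1] by (auto simp: P_def)
  next
    fix p n assume "P n p"
    then have p: "fst p \<in> I" "snd p \<in> J" "cnorm A (x \<ominus> (fst p \<oplus> snd p)) < (1/2) ^ n" by (auto simp: P_def)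
    obtain a b where ab: "a \<in> I" "b \<in> J" "cnorm A (x \<ominus> (a \<oplus> b)) < (1/2) ^ Suc n"
      using approx[of "(1/2) ^ Suc n"] by auto
    obtain a' b' where ab': "a' \<in> I" "b' \<in> J" "a' \<oplus> b' = (a \<ominus> fst p) \<oplus> (b \<ominus> snd p)"
      and n': "cnorm A a' \<le> 2 * cnorm A ((a \<ominus> fst p) \<oplus> (b \<ominus> snd p)) + (1/2) ^ n"
      using ideal_split[OF I J, of "a \<ominus> fst p" "b \<ominus> snd p" "(1/2) ^ n"] p ab
        closed_idealD(6)[OF I] closed_idealD(6)[OF J] by auto
    have car: "fst p \<in> carrier A" "snd p \<in> carrier A" "a \<in> carrier A" "b \<in> carrier A"
      "a' \<in> carrier A" "b' \<in> carrier A" using p ab ab' IJ_car by auto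
    have "(a \<ominus> fst p) \<oplus> (b \<ominus> snd p) = (x \<ominus> (fst p \<oplus> snd p)) \<ominus> (x \<ominus> (a \<oplus> b))"
      using car x by (simp add: expand_simps M.a_ac scale_combine)
    then have "cnorm A ((a \<ominus> fst p) \<oplus> (b \<ominus> snd p)) \<le> cnorm A (x \<ominus> (fst p \<oplus> snd p)) + cnorm A (x \<ominus> (a \<oplus> b))"
      using car x by (simp add: cnorm_diff_le)
    \<comment> \<open>Successive approximants differ by less than \<open>3/2\<close> times
      \<open>(1/2) ^ n\<close>; doubling and adding the tolerance \<open>(1/2) ^ n\<close> gives the
      factor \<open>4\<close>.\<close>
    then have "cnorm A a' \<le> 4 * (1/2) ^ n" using n' p(3) ab(3) by simp
    moreover have "(fst p \<oplus> a') \<oplus> (snd p \<oplus> b') = a \<oplus> b"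
    proof -
      have "(fst p \<oplus> a') \<oplus> (snd p \<oplus> b') = (fst p \<oplus> snd p) \<oplus> (a' \<oplus> b')" using car by (simp add: M.a_ac)
      also have "\<dots> = a \<oplus> b" unfolding ab'(3) using car by (simp add: expand_simps M.a_ac scale_combine)
      finally show ?thesis .
    qed
    moreover have "fst p \<oplus> a' \<ominus> fst p = a'" using car by (simp add: expand_simps M.a_ac scale_combine)
    ultimately have "P (Suc n) (fst p \<oplus> a', snd p \<oplus> b')"
      "cnorm A (fst (fst p \<oplus> a', snd p \<oplus> b') \<ominus> fst p) \<le> 4 * (1/2) ^ n"
      using ab(3) p ab' closed_idealD(4)[OF I] closed_idealD(4)[OF J] by (auto simp: P_def)
    then show "\<exists>q. P (Suc n) q \<and> cnorm A (fst q \<ominus> fst p) \<le> 4 * (1/2) ^ n" by blast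
  qed
  then obtain f where f: "\<And>n. P n (f n)"
    and step: "\<And>n. cnorm A (fst (f (Suc n)) \<ominus> fst (f n)) \<le> 4 * (1/2) ^ n" by blast
  have fI: "fst (f n) \<in> I" "snd (f n) \<in> J" "fst (f n) \<in> carrier A" "snd (f n) \<in> carrier A" for n
    using f[of n] IJ_car by (auto simp: P_def)
  obtain a where a: "a \<in> carrier A" and lim: "(\<lambda>n. cnorm A (fst (f n) \<ominus> a)) \<longlonglongrightarrow> 0"
    using geometric_convergent[OF fI(3) step] by blast
  have aI: "a \<in> I" by (rule norm_closed_limit[OF closed_idealD(9)[OF I] a fI(1,3) lim])
  have "x \<ominus> a \<in> J"
  proof (rule norm_closed_limit[OF closed_idealD(9)[OF J] _ fI(2,4)])
    show "x \<ominus> a \<in> carrier A" using x a by simp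
    have bound: "cnorm A (snd (f n) \<ominus> (x \<ominus> a)) \<le> cnorm A (fst (f n) \<ominus> a) + (1/2) ^ n" for n
    proof -
      have "snd (f n) \<ominus> (x \<ominus> a) = (-1) \<odot> ((fst (f n) \<ominus> a) \<oplus> (x \<ominus> (fst (f n) \<oplus> snd (f n))))"
        by (rule diff_regroup[OF a fI(4,3) x])
      then have "cnorm A (snd (f n) \<ominus> (x \<ominus> a)) = cnorm A ((fst (f n) \<ominus> a) \<oplus> (x \<ominus> (fst (f n) \<oplus> snd (f n))))"
        using x a fI[of n] by (simp add: cnorm_smult)
      also have "\<dots> \<le> cnorm A (fst (f n) \<ominus> a) + cnorm A (x \<ominus> (fst (f n) \<oplus> snd (f n)))"
        using x a fI[of n] by (intro cnorm_triangle) auto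
      finally show ?thesis using f[of n] by (simp add: P_def)
    qed
    have "(\<lambda>n. cnorm A (fst (f n) \<ominus> a) + (1/2) ^ n) \<longlonglongrightarrow> 0 + 0"
      by (intro tendsto_add lim LIMSEQ_power_zero) simp
    then have lim': "(\<lambda>n. cnorm A (fst (f n) \<ominus> a) + (1/2) ^ n) \<longlonglongrightarrow> 0" by simp
    have nonneg: "0 \<le> cnorm A (snd (f n) \<ominus> (x \<ominus> a))" for n
      using fI(4)[of n] x a by (simp add: cnorm_nonneg)
    show "(\<lambda>n. cnorm A (snd (f n) \<ominus> (x \<ominus> a))) \<longlonglongrightarrow> 0"
      by (rule tendsto_sandwich[OF always_eventually always_eventually tendsto_const lim'])
        (use bound nonneg in blast)+
  qed
  moreover have "x = a \<oplus> (x \<ominus> a)" using x a by (simp add: expand_simps M.a_ac scale_combine scale_gap)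
  ultimately show "x \<in> {a \<oplus> b | a b. a \<in> I \<and> b \<in> J}" using aI by blast
qed

lemma ideal_sum:
  assumes I: "closed_ideal A I" and J: "closed_ideal A J"
  shows "closed_ideal A {a \<oplus> b | a b. a \<in> I \<and> b \<in> J}" (is "closed_ideal A ?S")
proof (rule closed_idealI)
  note I' = closed_idealD[OF I] and J' = closed_idealD[OF J]
  show "?S \<subseteq> carrier A" using I'(2) J'(2) by auto
  show "\<zero> \<in> ?S" using I'(3) J'(3) M.l_zero[OF M.zero_closed] by force
  show "norm_closed A ?S" by (rule ideal_sum_norm_closed[OF I J])
  fix x assume "x \<in> ?S"
  then obtain a b where x: "x = a \<oplus> b" "a \<in> I" "b \<in> J" by blast
  have ab: "a \<in> carrier A" "b \<in> carrier A" using x I'(2) J'(2) by auto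
  have S_I: "p \<oplus> q \<in> ?S" if "p \<in> I" "q \<in> J" for p q using that by blast
  show "c \<odot> x \<in> ?S" for c
    unfolding x(1) scale_add_right[OF ab] using x(2,3) by (intro S_I I'(5) J'(5))
  show "z \<otimes> x \<in> ?S" if z: "z \<in> carrier A" for z
    unfolding x(1) distrib_left[OF z ab] using x(2,3) z by (intro S_I I'(7) J'(7))
  show "x \<otimes> z \<in> ?S" if z: "z \<in> carrier A" for z
    unfolding x(1) distrib_right[OF ab z] using x(2,3) z by (intro S_I I'(8) J'(8))
  fix y assume "y \<in> ?S"
  then obtain a' b' where y: "y = a' \<oplus> b'" "a' \<in> I" "b' \<in> J" by blast
  have "x \<oplus> y = (a \<oplus> a') \<oplus> (b \<oplus> b')" using x y ab I'(2) J'(2) by (simp add: M.a_ac)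
  then show "x \<oplus> y \<in> ?S" using x y I'(4) J'(4) by blast
qed


section \<open>Closed subspaces as preimages, and generated ideals\<close>

lemma norm_closed_ball:
  assumes "\<And>z. z \<in> Z \<Longrightarrow> norm_closed A {x \<in> carrier A. P z x}"
  shows "norm_closed A {x \<in> carrier A. \<forall>z\<in>Z. P z x}"
  unfolding norm_closed_def
proof (intro ballI impI CollectI conjI)
  fix x z assume x: "x \<in> carrier A" "\<forall>\<epsilon>>0. \<exists>y\<in>{x \<in> carrier A. \<forall>z\<in>Z. P z x}. cnorm A (x \<ominus> y) < \<epsilon>"
    and z: "z \<in> Z"
  then have "\<forall>\<epsilon>>0. \<exists>y\<in>{x \<in> carrier A. P z x}. cnorm A (x \<ominus> y) < \<epsilon>" by fast
  then show "P z x" using assms[OF z] x(1) unfolding norm_closed_def by fast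
qed

text \<open>The parameter \<open>g\<close> admits conjugate-linear maps, so that the adjoint is
  covered with \<open>g = cnj\<close>.\<close>

lemma closed_subspace_vimage:
  assumes H: "closed_subspace A H" and f: "\<And>x. x \<in> carrier A \<Longrightarrow> f x \<in> carrier A"
    and add: "\<And>x y. x \<in> carrier A \<Longrightarrow> y \<in> carrier A \<Longrightarrow> f (x \<oplus> y) = f x \<oplus> f y"
    and scale: "\<And>c x. x \<in> carrier A \<Longrightarrow> f (c \<odot> x) = g c \<odot> f x"
    and bound: "\<And>x. x \<in> carrier A \<Longrightarrow> cnorm A (f x) \<le> C * cnorm A x"
  shows "closed_subspace A {x \<in> carrier A. f x \<in> H}"
proof -
  have f0: "f \<zero> = \<zero>" using add[of \<zero> \<zero>] f[of \<zero>] by simp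
  have neg: "f ((-1) \<odot> y) = (-1) \<odot> f y" if y: "y \<in> carrier A" for y
  proof -
    have "f y \<oplus> f ((-1) \<odot> y) = \<zero>"
      using add[of y "(-1) \<odot> y"] f0 y by (simp add: scale_combine)
    then have "f ((-1) \<odot> y) = \<ominus> f y" using f y by (intro M.minus_equality[symmetric]) (auto simp: M.a_comm)
    then show ?thesis using f y by (simp add: minus_eq_scale)
  qed
  have diff: "f x \<ominus> f y = f (x \<ominus> y)" if "x \<in> carrier A" "y \<in> carrier A" for x y
    using that f by (simp add: diff_eq_scale add neg)
  have "norm_closed A {x \<in> carrier A. f x \<in> H}"
    using H f bound diff by (intro norm_closed_vimage[where C = C]) (simp_all add: closed_subspace_def)
  then show ?thesis using H f0 by (simp add: closed_subspace_def add scale Collect_conj_eq)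
qed

lemma closed_subspace_mult:
  assumes H: "closed_subspace A H" and a: "a \<in> carrier A"
  shows "closed_subspace A {x \<in> carrier A. a \<otimes> x \<in> H}" "closed_subspace A {x \<in> carrier A. x \<otimes> a \<in> H}"
proof -
  show "closed_subspace A {x \<in> carrier A. a \<otimes> x \<in> H}"
    by (rule closed_subspace_vimage[OF H, where C = "cnorm A a" and g = "\<lambda>c. c"])
      (use a cnorm_mult in \<open>simp_all add: distrib_left smult_mult_right\<close>)
  show "closed_subspace A {x \<in> carrier A. x \<otimes> a \<in> H}"
    by (rule closed_subspace_vimage[OF H, where C = "cnorm A a" and g = "\<lambda>c. c"])
      (use a cnorm_mult[of _ a] in \<open>simp_all add: distrib_right smult_mult_left mult.commute\<close>)
qed

lemma closed_subspace_adj: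
  assumes H: "closed_subspace A H"
  shows "closed_subspace A {x \<in> carrier A. adj A x \<in> H}"
  by (rule closed_subspace_vimage[OF H, where C = 1 and g = cnj])
    (simp_all add: adj_add adj_smult cnorm_adj)

lemma closed_subspace_ball:
  assumes "\<And>z. z \<in> Z \<Longrightarrow> closed_subspace A {x \<in> carrier A. P z x}"
  shows "closed_subspace A {x \<in> carrier A. \<forall>z\<in>Z. P z x}"
  using assms norm_closed_ball[of Z P] by (simp add: closed_subspace_def Collect_conj_eq)

lemma closed_ideal_carrier: "closed_ideal A (carrier A)"
  by (rule closed_idealI) (auto simp: norm_closed_def)

text \<open>Stability of \<open>Z\<close> makes the set two-sided:
  \<open>(x \<otimes> a) \<otimes> z = x \<otimes> (a \<otimes> z)\<close>, and
  \<open>a \<otimes> z\<close> is again in \<open>Z\<close>.\<close>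

lemma left_transporter_ideal:
  assumes H: "closed_ideal A H" and Z: "Z \<subseteq> carrier A"
    and stable: "\<And>y z. y \<in> carrier A \<Longrightarrow> z \<in> Z \<Longrightarrow> y \<otimes> z \<in> Z"
  shows "closed_ideal A {x \<in> carrier A. \<forall>z\<in>Z. x \<otimes> z \<in> H}"
proof -
  have "closed_subspace A {x \<in> carrier A. \<forall>z\<in>Z. x \<otimes> z \<in> H}"
    using H Z by (intro closed_subspace_ball closed_subspace_mult) (auto simp: closed_ideal_def)
  then show ?thesis using closed_idealD(7)[OF H] Z stable
    by (auto simp: closed_ideal_def mult_assoc subset_eq)
qed

lemma right_transporter_ideal:
  assumes H: "closed_ideal A H" and Z: "Z \<subseteq> carrier A"
    and stable: "\<And>y z. y \<in> carrier A \<Longrightarrow> z \<in> Z \<Longrightarrow> z \<otimes> y \<in> Z"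
  shows "closed_ideal A {x \<in> carrier A. \<forall>z\<in>Z. z \<otimes> x \<in> H}"
proof -
  have "closed_subspace A {x \<in> carrier A. \<forall>z\<in>Z. z \<otimes> x \<in> H}"
    using H Z by (intro closed_subspace_ball closed_subspace_mult) (auto simp: closed_ideal_def)
  then show ?thesis using closed_idealD(8)[OF H] Z stable
    by (auto simp: closed_ideal_def mult_assoc[symmetric] subset_eq)
qed

lemma ideal_gen_minimal: "closed_ideal A I \<Longrightarrow> C \<subseteq> I \<Longrightarrow> ideal_gen A C \<subseteq> I"
  unfolding ideal_gen_def by (rule hull_minimal)

lemma subset_ideal_gen: "C \<subseteq> ideal_gen A C"
  unfolding ideal_gen_def by (rule hull_subset)

lemma ideal_gen_closed_ideal:
  assumes "C \<subseteq> carrier A"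
  shows "closed_ideal A (ideal_gen A C)"
proof -
  define F where "F = {I. closed_ideal A I \<and> C \<subseteq> I}"
  \<comment> \<open>The hull is the intersection of the members of \<open>F\<close>, and
    \<open>carrier A\<close> is one of them.\<close>
  have gen: "ideal_gen A C = {x \<in> carrier A. \<forall>I\<in>F. x \<in> I}"
    using closed_ideal_carrier assms by (auto simp: ideal_gen_def hull_def F_def)
  have "closed_subspace A {x \<in> carrier A. \<forall>I\<in>F. x \<in> I}"
  proof (rule closed_subspace_ball)
    fix I assume "I \<in> F"
    then have "closed_subspace A I" by (simp add: F_def closed_ideal_def)
    then show "closed_subspace A {x \<in> carrier A. x \<in> I}"
      using closed_subspace_def by (metis Collect_mem_eq Int_absorb1 Int_def)
  qed
  then show ?thesis unfolding gen by (auto simp: closed_ideal_def F_def)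
qed

text \<open>Two passes with transporter ideals: the elements carrying \<open>D\<close> and its left
  multiples into \<open>H\<close> form a closed ideal containing \<open>C\<close>; then the elements
  that all of \<open>ideal_gen A C\<close> carries into \<open>H\<close> form one containing
  \<open>D\<close>. Without a unit, \<open>CD\<close> is not an instance of
  \<open>CyD\<close>.\<close>

lemma ideal_gen_mult:
  assumes C: "C \<subseteq> carrier A" and D: "D \<subseteq> carrier A" and H: "closed_ideal A H"
    and CD: "\<And>a b. a \<in> C \<Longrightarrow> b \<in> D \<Longrightarrow> a \<otimes> b \<in> H"
    and CyD: "\<And>a y b. a \<in> C \<Longrightarrow> y \<in> carrier A \<Longrightarrow> b \<in> D \<Longrightarrow> a \<otimes> (y \<otimes> b) \<in> H"
    and x: "x \<in> ideal_gen A C" and y: "y \<in> ideal_gen A D"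
  shows "x \<otimes> y \<in> H"
proof -
  define Z where "Z = D \<union> {y \<otimes> b | y b. y \<in> carrier A \<and> b \<in> D}"
  have ZD: "Z \<subseteq> carrier A" using D by (auto simp: Z_def)
  have "w \<otimes> z \<in> Z" if wz: "w \<in> carrier A" "z \<in> Z" for w z
  proof -
    consider "z \<in> D" | y b where "z = y \<otimes> b" "y \<in> carrier A" "b \<in> D"
      using wz(2) unfolding Z_def by blast
    then show ?thesis
    proof cases
      case 1
      then show ?thesis using wz by (auto simp: Z_def)
    next
      case 2
      then have "w \<otimes> z = (w \<otimes> y) \<otimes> b" "w \<otimes> y \<in> carrier A" using wz D by (auto simp: mult_assoc)
      then show ?thesis using 2 unfolding Z_def by blast
    qed
  qed
  note T = left_transporter_ideal[OF H ZD this]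
  have "C \<subseteq> {x \<in> carrier A. \<forall>z\<in>Z. x \<otimes> z \<in> H}"
    using C CD CyD by (auto simp: Z_def)
  from ideal_gen_minimal[OF T this]
  have 1: "x \<otimes> b \<in> H" if "x \<in> ideal_gen A C" "b \<in> D" for x b
    using that by (auto simp: Z_def)
  note I = ideal_gen_closed_ideal[OF C]
  note T' = right_transporter_ideal[OF H closed_idealD(1)[OF I] closed_idealD(8)[OF I]]
  have "D \<subseteq> {y \<in> carrier A. \<forall>z\<in>ideal_gen A C. z \<otimes> y \<in> H}"
    using D 1 by auto
  from ideal_gen_minimal[OF T' this] show ?thesis using x y by auto
qed

section \<open>Arithmetic of cosets\<close>

lemma diff_self: "x \<in> carrier A \<Longrightarrow> x \<ominus> x = \<zero>"
  by (simp add: diff_zero_iff)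

lemma mem_coset_iff:
  assumes I: "closed_ideal A I" and x: "x \<in> carrier A"
  shows "y \<in> I +> x \<longleftrightarrow> y \<in> carrier A \<and> y \<ominus> x \<in> I"
proof
  assume "y \<in> I +> x"
  then obtain i where i: "i \<in> I" "y = i \<oplus> x" by (auto simp: a_r_coset_def')
  have "i \<in> carrier A" using closed_idealD(2)[OF I i(1)] .
  then show "y \<in> carrier A \<and> y \<ominus> x \<in> I" using i x by (simp add: expand_simps M.a_ac scale_combine scale_gap)
next
  assume "y \<in> carrier A \<and> y \<ominus> x \<in> I"
  moreover from this have "y = (y \<ominus> x) \<oplus> x" using x by (simp add: diff_add_cancel)
  ultimately show "y \<in> I +> x" by (auto simp: a_r_coset_def')
qed

lemma coset_eq_iff:
  assumes I: "closed_ideal A I" and x: "x \<in> carrier A" and y: "y \<in> carrier A"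
  shows "I +> x = I +> y \<longleftrightarrow> x \<ominus> y \<in> I"
proof
  assume "I +> x = I +> y"
  moreover have "x \<in> I +> x" using mem_coset_iff[OF I x] x closed_idealD(3)[OF I] by (simp add: diff_self)
  ultimately show "x \<ominus> y \<in> I" using mem_coset_iff[OF I y] by simp
next
  assume xy: "x \<ominus> y \<in> I"
  have "z \<ominus> x \<in> I \<longleftrightarrow> z \<ominus> y \<in> I" if z: "z \<in> carrier A" for z
  proof -
    have "z \<ominus> y = (z \<ominus> x) \<oplus> (x \<ominus> y)" "z \<ominus> x = (z \<ominus> y) \<ominus> (x \<ominus> y)"
      using x y z by (simp_all add: expand_simps M.a_ac scale_combine scale_gap)
    then show ?thesis using xy closed_idealD(4,6)[OF I] by metis
  qed
  then show "I +> x = I +> y" using mem_coset_iff[OF I x] mem_coset_iff[OF I y] by auto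
qed

lemma coset_zero: "closed_ideal A I \<Longrightarrow> I +> \<zero> = I"
  using closed_idealD(1) by (rule M.a_coset_add_zero)

lemma coset_eq_ideal_iff:
  assumes "closed_ideal A I" "x \<in> carrier A"
  shows "I +> x = I \<longleftrightarrow> x \<in> I"
  using coset_eq_iff[OF assms M.zero_closed] coset_zero[OF assms(1)] assms(2)
  by (simp add: diff_eq_scale)

text \<open>Several operations of \<open>quot\<close>, and \<open>induced\<close>, are unions over
  representatives; such a union collapses to a single coset when \<open>f\<close> respects
  congruence.\<close>

lemma UN_coset:
  assumes I: "closed_ideal A I" and J: "closed_ideal A J" and x: "x \<in> carrier A"
    and f: "\<And>y. y \<in> carrier A \<Longrightarrow> f y \<in> carrier A"
    and cong: "\<And>y. y \<in> carrier A \<Longrightarrow> y \<ominus> x \<in> I \<Longrightarrow> f y \<ominus> f x \<in> J"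
  shows "(\<Union>y\<in>I +> x. J +> f y) = J +> f x"
proof -
  have "J +> f y = J +> f x" if "y \<in> I +> x" for y
    using that cong f x by (simp add: mem_coset_iff[OF I x] coset_eq_iff[OF J])
  moreover have "x \<in> I +> x" using mem_coset_iff[OF I x] x closed_idealD(3)[OF I] by (simp add: diff_self)
  ultimately show ?thesis by blast
qed

lemma coset_add:
  assumes I: "closed_ideal A I" and x: "x \<in> carrier A" and y: "y \<in> carrier A"
  shows "set_add A (I +> x) (I +> y) = I +> (x \<oplus> y)"
proof -
  have "set_add A (I +> x) (I +> y) \<subseteq> I +> (x \<oplus> y)"
  proof
    fix z assume "z \<in> set_add A (I +> x) (I +> y)"
    then obtain i j where ij: "i \<in> I" "j \<in> I" "z = (i \<oplus> x) \<oplus> (j \<oplus> y)"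
      by (auto simp: set_add_def' a_r_coset_def')
    then have "z = (i \<oplus> j) \<oplus> (x \<oplus> y)" using x y closed_idealD(2)[OF I] by (simp add: M.a_ac)
    then show "z \<in> I +> (x \<oplus> y)" using ij closed_idealD(4)[OF I] by (auto simp: a_r_coset_def')
  qed
  moreover have "I +> (x \<oplus> y) \<subseteq> set_add A (I +> x) (I +> y)"
  proof
    fix z assume "z \<in> I +> (x \<oplus> y)"
    then obtain i where i: "i \<in> I" "z = i \<oplus> (x \<oplus> y)" by (auto simp: a_r_coset_def')
    then have "z = (i \<oplus> x) \<oplus> (\<zero> \<oplus> y)" using x y closed_idealD(2)[OF I] by (simp add: M.a_ac)
    then show "z \<in> set_add A (I +> x) (I +> y)" using i closed_idealD(3)[OF I]
      unfolding set_add_def' a_r_coset_def' by blast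
  qed
  ultimately show ?thesis by blast
qed

lemma coset_mult:
  assumes I: "closed_ideal A I" and x: "x \<in> carrier A" and y: "y \<in> carrier A"
  shows "rcoset_mult A I (I +> x) (I +> y) = I +> (x \<otimes> y)"
proof -
  note D = closed_idealD[OF I]
  have inner: "(\<Union>b\<in>I +> y. I +> (a \<otimes> b)) = I +> (a \<otimes> y)" if a: "a \<in> carrier A" for a
  proof (rule UN_coset[OF I I y])
    fix b assume b: "b \<in> carrier A" "b \<ominus> y \<in> I"
    have "a \<otimes> b \<ominus> a \<otimes> y = a \<otimes> (b \<ominus> y)" using a b y by (simp add: expand_simps)
    then show "a \<otimes> b \<ominus> a \<otimes> y \<in> I" using D(7) a b by simp
  qed (use a in simp)
  have "rcoset_mult A I (I +> x) (I +> y) = (\<Union>a\<in>I +> x. \<Union>b\<in>I +> y. I +> (a \<otimes> b))"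
    by (simp add: rcoset_mult_def)
  also have "\<dots> = (\<Union>a\<in>I +> x. I +> (a \<otimes> y))"
    using inner mem_coset_iff[OF I x] by simp
  also have "\<dots> = I +> (x \<otimes> y)"
  proof (rule UN_coset[OF I I x])
    fix a assume a: "a \<in> carrier A" "a \<ominus> x \<in> I"
    have "a \<otimes> y \<ominus> x \<otimes> y = (a \<ominus> x) \<otimes> y" using a x y by (simp add: expand_simps)
    then show "a \<otimes> y \<ominus> x \<otimes> y \<in> I" using D(8) a y by simp
  qed (use y in simp)
  finally show ?thesis .
qed

lemma coset_smult:
  assumes I: "closed_ideal A I" and x: "x \<in> carrier A"
  shows "(\<Union>y\<in>I +> x. I +> (c \<odot> y)) = I +> (c \<odot> x)"
proof (rule UN_coset[OF I I x])
  fix y assume y: "y \<in> carrier A" "y \<ominus> x \<in> I"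
  have "c \<odot> y \<ominus> c \<odot> x = c \<odot> (y \<ominus> x)" using x y by (simp add: expand_simps mult.commute)
  then show "c \<odot> y \<ominus> c \<odot> x \<in> I" using closed_idealD(5)[OF I] y by simp
qed simp

text \<open>Independence of the representative rests on the self-adjointness of closed
  ideals.\<close>

lemma coset_adj:
  assumes I: "closed_ideal A I" and x: "x \<in> carrier A"
  shows "(\<Union>y\<in>I +> x. I +> adj A y) = I +> adj A x"
proof (rule UN_coset[OF I I x])
  fix y assume y: "y \<in> carrier A" "y \<ominus> x \<in> I"
  have "adj A y \<ominus> adj A x = adj A (y \<ominus> x)" using x y by (simp add: expand_simps)
  then show "adj A y \<ominus> adj A x \<in> I" using ideal_adj[OF I] y by simp
qed simp

end

section \<open>Exact sequences of quotients\<close>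

text \<open>An ideal is regarded as an algebra by replacing the carrier of the record. The coset
  operations do not look at that field, so facts about cosets in \<open>A\<close> apply.\<close>

lemma coset_restrict [simp]:
  "a_r_coset (A\<lparr>carrier := M\<rparr>) I x = a_r_coset A I x"
  "set_add (A\<lparr>carrier := M\<rparr>) S T = set_add A S T"
  "rcoset_mult (A\<lparr>carrier := M\<rparr>) I S T = rcoset_mult A I S T"
  for A :: "('a, 'm) cstar_scheme"
  by (simp_all add: a_r_coset_def' set_add_def' rcoset_mult_def)

lemma carrier_quot_restrict: "carrier (quot (A\<lparr>carrier := M\<rparr>) I) = (\<lambda>x. a_r_coset A I x) ` M"
  by (auto simp: quot_def A_RCOSETS_def')

locale cstar_quotients = cstar_algebra A for A :: "'a cstar" (structure)
begin

lemma induced_coset: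
  assumes I: "closed_ideal A I" and J: "closed_ideal A J" and "I \<subseteq> J" and x: "x \<in> carrier A"
  shows "induced A J (I +> x) = J +> x"
  unfolding induced_def using assms by (intro UN_coset[where f = "\<lambda>y. y"]) auto

lemma star_hom_restrict_incl: "N \<subseteq> N' \<Longrightarrow> star_hom (A\<lparr>carrier := N\<rparr>) (A\<lparr>carrier := N'\<rparr>) (\<lambda>x. x)"
  by (auto simp: star_hom_def)

lemma star_hom_coset:
  assumes I: "closed_ideal A I" and N: "N \<subseteq> M" and M: "M \<subseteq> carrier A"
  shows "star_hom (A\<lparr>carrier := N\<rparr>) (quot (A\<lparr>carrier := M\<rparr>) I) (\<lambda>x. I +> x)"
proof -
  have [simp]: "x \<in> carrier A" if "x \<in> N" for x using that N M by blast
  show ?thesis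
    using N unfolding star_hom_def carrier_quot_restrict
    by (auto simp: quot_def coset_add[OF I] coset_mult[OF I] coset_smult[OF I] coset_adj[OF I])
qed

lemma star_hom_induced:
  assumes I: "closed_ideal A I" and J: "closed_ideal A J" and "I \<subseteq> J"
    and M: "closed_ideal A M" and "M \<subseteq> N" "N \<subseteq> carrier A"
  shows "star_hom (quot (A\<lparr>carrier := M\<rparr>) I) (quot (A\<lparr>carrier := N\<rparr>) J) (induced A J)"
proof -
  note D = closed_idealD[OF M]
  note ind = induced_coset[OF I J \<open>I \<subseteq> J\<close>]
  show ?thesis
    using \<open>M \<subseteq> N\<close> D(2) unfolding star_hom_def carrier_quot_restrict
    by (auto simp: quot_def ind coset_add[OF I] coset_mult[OF I] coset_smult[OF I] coset_adj[OF I]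
        coset_add[OF J] coset_mult[OF J] coset_smult[OF J] coset_adj[OF J])
qed

text \<open>Covers the first two rows and columns: the kernel of the map from \<open>N\<close> to
  \<open>M/I\<close> is \<open>N \<inter> I\<close>, and \<open>onto\<close> says that
  \<open>M\<close> is contained in \<open>N + I\<close>.\<close>

lemma short_exact_ideal:
  assumes I: "closed_ideal A I" and M: "closed_ideal A M" and N: "closed_ideal A N"
    and "N \<subseteq> M" and P: "P = N \<inter> I" and onto: "\<And>m. m \<in> M \<Longrightarrow> \<exists>n\<in>N. m \<ominus> n \<in> I"
  shows "short_exact (A\<lparr>carrier := P\<rparr>) (\<lambda>x. x) (A\<lparr>carrier := N\<rparr>) (\<lambda>x. I +> x) (quot (A\<lparr>carrier := M\<rparr>) I)"
  unfolding short_exact_def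
proof (intro conjI)
  note D = closed_idealD[OF N] and DM = closed_idealD[OF M]
  show "star_hom (A\<lparr>carrier := P\<rparr>) (A\<lparr>carrier := N\<rparr>) (\<lambda>x. x)" by (rule star_hom_restrict_incl) (simp add: P)
  show "star_hom (A\<lparr>carrier := N\<rparr>) (quot (A\<lparr>carrier := M\<rparr>) I) (\<lambda>x. I +> x)"
    by (rule star_hom_coset[OF I \<open>N \<subseteq> M\<close> DM(1)])
  show "{x \<in> carrier (A\<lparr>carrier := P\<rparr>). x = \<zero>\<^bsub>A\<lparr>carrier := N\<rparr>\<^esub>} = {\<zero>\<^bsub>A\<lparr>carrier := P\<rparr>\<^esub>}"
    using D(3) closed_idealD(3)[OF I] by (auto simp: P)
  show "(\<lambda>x. x) ` carrier (A\<lparr>carrier := P\<rparr>) =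
      {y \<in> carrier (A\<lparr>carrier := N\<rparr>). I +> y = \<zero>\<^bsub>quot (A\<lparr>carrier := M\<rparr>) I\<^esub>}"
    using D(2) by (simp add: P quot_def coset_eq_ideal_iff[OF I] Int_def cong: conj_cong)
  show "(\<lambda>x. I +> x) ` carrier (A\<lparr>carrier := N\<rparr>) = carrier (quot (A\<lparr>carrier := M\<rparr>) I)"
  proof -
    have "I +> m \<in> (\<lambda>x. I +> x) ` N" if m: "m \<in> M" for m
    proof -
      obtain n where n: "n \<in> N" "m \<ominus> n \<in> I" using onto[OF m] by blast
      then have "I +> m = I +> n" using coset_eq_iff[OF I DM(2)[OF m] D(2)] by simp
      then show ?thesis using n by blast
    qed
    then show ?thesis using \<open>N \<subseteq> M\<close> unfolding carrier_quot_restrict by auto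
  qed
qed

text \<open>The exact sequence of the third isomorphism theorem, for the third row and column: a
  coset of \<open>I\<close> becomes zero modulo \<open>M\<close> exactly when its representatives
  lie in \<open>M\<close>.\<close>

lemma short_exact_quot:
  assumes I: "closed_ideal A I" and M: "closed_ideal A M" and "I \<subseteq> M"
  shows "short_exact (quot (A\<lparr>carrier := M\<rparr>) I) (induced A I) (quot A I) (induced A M) (quot A M)"
proof -
  note D = closed_idealD[OF M] and ind = induced_coset[OF I I order_refl] induced_coset[OF I M \<open>I \<subseteq> M\<close>]
  have full: "quot A J = quot (A\<lparr>carrier := carrier A\<rparr>) J" for J by simp
  have carr: "carrier (quot A J) = (\<lambda>x. J +> x) ` carrier A" for J
    by (subst full) (rule carrier_quot_restrict)
  have zero: "\<zero>\<^bsub>quot X' J\<^esub> = J" for X' :: "'a cstar" and J by (simp add: quot_def)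
  show ?thesis
    unfolding short_exact_def
  proof (intro conjI)
    show "star_hom (quot (A\<lparr>carrier := M\<rparr>) I) (quot A I) (induced A I)"
      using star_hom_induced[OF I I order_refl M D(1) order_refl] by simp
    show "star_hom (quot A I) (quot A M) (induced A M)"
      using star_hom_induced[OF I M \<open>I \<subseteq> M\<close> closed_ideal_carrier order_refl order_refl] by simp
    show "{x \<in> carrier (quot (A\<lparr>carrier := M\<rparr>) I). induced A I x = \<zero>\<^bsub>quot A I\<^esub>} = {\<zero>\<^bsub>quot (A\<lparr>carrier := M\<rparr>) I\<^esub>}"
      unfolding carrier_quot_restrict zero
      using D(2,3) ind(1) ind(1)[OF M.zero_closed] coset_zero[OF I]
      by (auto intro!: image_eqI[of _ _ \<zero>])
    show "induced A I ` carrier (quot (A\<lparr>carrier := M\<rparr>) I) = {y \<in> carrier (quot A I). induced A M y = \<zero>\<^bsub>quot A M\<^esub>}"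
    proof -
      have "{x \<in> carrier A. induced A M (I +> x) = M} = M"
        using D(2) by (simp add: ind(2) coset_eq_ideal_iff[OF M] Int_def[symmetric] cong: conj_cong) auto
      moreover have "induced A I ` (\<lambda>x. I +> x) ` M = (\<lambda>x. I +> x) ` M"
        unfolding image_image using D(2) by (intro image_cong) (simp_all add: ind(1))
      ultimately show ?thesis unfolding carrier_quot_restrict carr zero Compr_image_eq by simp
    qed
    show "induced A M ` carrier (quot A I) = carrier (quot A M)"
      unfolding carr image_image by (rule image_cong) (simp_all add: ind)
  qed
qed


section \<open>Toeplitz-Cuntz-Krieger algebras\<close>

text \<open>Infinite \<open>J\<close> is included: both sums are then \<open>\<zero>\<close> by
  convention, and an additive \<open>f\<close> fixes \<open>\<zero>\<close>.\<close>

lemma finsum_additive: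
  assumes f: "\<And>x. x \<in> carrier A \<Longrightarrow> f x \<in> carrier A"
    and add: "\<And>x y. x \<in> carrier A \<Longrightarrow> y \<in> carrier A \<Longrightarrow> f (x \<oplus> y) = f x \<oplus> f y"
    and g: "\<And>i. i \<in> J \<Longrightarrow> g i \<in> carrier A"
  shows "f (\<Oplus>i\<in>J. g i) = (\<Oplus>i\<in>J. f (g i))"
proof -
  have f0: "f \<zero> = \<zero>" using add[of \<zero> \<zero>] f[of \<zero>] by simp
  show ?thesis
    using g
  proof (induction J rule: infinite_finite_induct)
    case (insert i J)
    then show ?case by (simp add: f add Pi_def)
  qed (simp_all add: f0 M.finsum_infinite)
qed

lemma finsum_mem:
  assumes S: "closed_subspace A S" and g: "\<And>i. i \<in> J \<Longrightarrow> g i \<in> S"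
  shows "(\<Oplus>i\<in>J. g i) \<in> S"
  using g
proof (induction J rule: infinite_finite_induct)
  case (insert i J)
  have "S \<subseteq> carrier A" using S by (simp add: closed_subspace_def)
  then have "g j \<in> carrier A" if "j \<in> insert i J" for j using insert.prems that by blast
  then show ?case using insert S by (simp add: Pi_def closed_subspace_def)
qed (use S in \<open>simp_all add: closed_subspace_def M.finsum_infinite\<close>)

lemma finsum_in_carrier: "(\<And>i. i \<in> J \<Longrightarrow> g i \<in> carrier A) \<Longrightarrow> (\<Oplus>i\<in>J. g i) \<in> carrier A"
  by (rule M.finsum_closed) simp

lemma closed_subspace_hull:
  assumes "C \<subseteq> carrier A"
  shows "closed_subspace A (closed_subspace A hull C)"
proof -
  define F where "F = {S. closed_subspace A S \<and> C \<subseteq> S}"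
  have "carrier A \<in> F" using closed_ideal_carrier assms by (auto simp: F_def closed_ideal_def)
  then have hull: "closed_subspace A hull C = {x \<in> carrier A. \<forall>S\<in>F. x \<in> S}"
    by (auto simp: hull_def F_def)
  show ?thesis unfolding hull
  proof (rule closed_subspace_ball)
    fix S assume "S \<in> F"
    then have "closed_subspace A S" by (simp add: F_def)
    then show "closed_subspace A {x \<in> carrier A. x \<in> S}"
      using closed_subspace_def by (metis Collect_mem_eq Int_absorb1 Int_def)
  qed
qed

end

locale TCK_algebra = cstar_quotients A + k_graph k \<Lambda> for A :: "'a cstar" (structure) and k and \<Lambda> :: "'l graph" +
  fixes t :: "'l \<Rightarrow> 'a"
  assumes family: "TCK_family \<Lambda> A t" and rows: "row_finite k \<Lambda>"
    and generates: "cstar_subalgebra A hull (t ` mor \<Lambda>) = carrier A"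
begin

lemma t_closed [simp]: "\<alpha> \<in> mor \<Lambda> \<Longrightarrow> t \<alpha> \<in> carrier A"
  using family by (auto simp: TCK_family_def)

lemma t_partial_isometry: "\<alpha> \<in> mor \<Lambda> \<Longrightarrow> t \<alpha> \<otimes> (adj A (t \<alpha>) \<otimes> t \<alpha>) = t \<alpha>"
  using family mult_assoc[of "t \<alpha>" "adj A (t \<alpha>)" "t \<alpha>"] by (auto simp: TCK_family_def)

lemma vertex_mor: "v \<in> vertices \<Lambda> \<Longrightarrow> v \<in> mor \<Lambda>"
  by (simp add: vertices_def paths_def)

lemma rng_vertex: "\<alpha> \<in> mor \<Lambda> \<Longrightarrow> rng \<Lambda> \<alpha> \<in> vertices \<Lambda>"
  by (simp add: vertices_def paths_def rng_closed deg_rng)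

lemma src_vertex: "\<alpha> \<in> mor \<Lambda> \<Longrightarrow> src \<Lambda> \<alpha> \<in> vertices \<Lambda>"
  by (simp add: vertices_def paths_def src_closed deg_src)

lemma t_vertex:
  "v \<in> vertices \<Lambda> \<Longrightarrow> adj A (t v) = t v" "v \<in> vertices \<Lambda> \<Longrightarrow> t v \<otimes> t v = t v"
  "v \<in> vertices \<Lambda> \<Longrightarrow> w \<in> vertices \<Lambda> \<Longrightarrow> v \<noteq> w \<Longrightarrow> t v \<otimes> t w = \<zero>"
  using family by (auto simp: TCK_family_def)

lemma t_comp: "\<alpha> \<in> mor \<Lambda> \<Longrightarrow> \<mu> \<in> mor \<Lambda> \<Longrightarrow> src \<Lambda> \<alpha> = rng \<Lambda> \<mu> \<Longrightarrow> t \<alpha> \<otimes> t \<mu> = t (cmp \<Lambda> \<alpha> \<mu>)"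
  using family by (simp add: TCK_family_def)

lemma t_adj_t: "\<alpha> \<in> mor \<Lambda> \<Longrightarrow> \<mu> \<in> mor \<Lambda> \<Longrightarrow>
    adj A (t \<alpha>) \<otimes> t \<mu> = (\<Oplus>p\<in>min_ext \<Lambda> \<alpha> \<mu>. t (fst p) \<otimes> adj A (t (snd p)))"
  using family by (simp add: TCK_family_def)

lemma t_rng: "\<alpha> \<in> mor \<Lambda> \<Longrightarrow> t (rng \<Lambda> \<alpha>) \<otimes> t \<alpha> = t \<alpha>"
  by (simp add: t_comp rng_closed src_rng comp_rng)

lemma t_src: "\<alpha> \<in> mor \<Lambda> \<Longrightarrow> t \<alpha> \<otimes> t (src \<Lambda> \<alpha>) = t \<alpha>"
  by (simp add: t_comp src_closed rng_src comp_src)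

lemma adj_t_rng: "\<alpha> \<in> mor \<Lambda> \<Longrightarrow> adj A (t \<alpha>) \<otimes> t (rng \<Lambda> \<alpha>) = adj A (t \<alpha>)"
  using adj_mult[of "t (rng \<Lambda> \<alpha>)" "t \<alpha>"] by (simp add: t_rng t_vertex(1) rng_vertex rng_closed)

section \<open>Gap elements and their commutation with paths\<close>

abbreviation edges :: "'l \<Rightarrow> nat \<Rightarrow> 'l set" where
  "edges v i \<equiv> paths_to \<Lambda> v (unit_deg i)"

lemma edgesD: "e \<in> edges v i \<Longrightarrow> e \<in> mor \<Lambda>" "e \<in> edges v i \<Longrightarrow> rng \<Lambda> e = v"
  "e \<in> edges v i \<Longrightarrow> deg \<Lambda> e = unit_deg i"
  by (auto simp: paths_to_def paths_def)

lemma gap_closed [simp]: "v \<in> vertices \<Lambda> \<Longrightarrow> gap \<Lambda> A t v i \<in> carrier A"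
  unfolding gap_def by (intro M.minus_closed finsum_in_carrier) (auto simp: vertex_mor edgesD(1))

lemma gap_mult:
  assumes v: "v \<in> vertices \<Lambda>" and x: "x \<in> carrier A"
  shows "gap \<Lambda> A t v i \<otimes> x = t v \<otimes> x \<ominus> (\<Oplus>e\<in>edges v i. t e \<otimes> (adj A (t e) \<otimes> x))"
proof -
  have sum: "(\<Oplus>e\<in>edges v i. t e \<otimes> adj A (t e)) \<in> carrier A"
    by (rule finsum_in_carrier) (simp add: edgesD(1))
  have "(\<Oplus>e\<in>edges v i. t e \<otimes> adj A (t e)) \<otimes> x = (\<Oplus>e\<in>edges v i. (t e \<otimes> adj A (t e)) \<otimes> x)"
    using x by (intro finsum_additive) (auto simp: distrib_right edgesD(1))
  also have "\<dots> = (\<Oplus>e\<in>edges v i. t e \<otimes> (adj A (t e) \<otimes> x))"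
    using x by (intro M.finsum_cong') (auto simp: mult_assoc edgesD(1))
  finally have eq: "(\<Oplus>e\<in>edges v i. t e \<otimes> adj A (t e)) \<otimes> x = (\<Oplus>e\<in>edges v i. t e \<otimes> (adj A (t e) \<otimes> x))" .
  have "(p \<ominus> q) \<otimes> x = p \<otimes> x \<ominus> q \<otimes> x" if "p \<in> carrier A" "q \<in> carrier A" for p q
    using that x by (simp add: expand_simps)
  from this[OF t_closed[OF vertex_mor[OF v]] sum] show ?thesis unfolding gap_def eq .
qed

lemma gap_adj:
  assumes v: "v \<in> vertices \<Lambda>"
  shows "adj A (gap \<Lambda> A t v i) = gap \<Lambda> A t v i"
proof -
  have sum: "(\<Oplus>e\<in>edges v i. t e \<otimes> adj A (t e)) \<in> carrier A"
    by (rule finsum_in_carrier) (simp add: edgesD(1))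
  have "adj A (\<Oplus>e\<in>edges v i. t e \<otimes> adj A (t e)) = (\<Oplus>e\<in>edges v i. adj A (t e \<otimes> adj A (t e)))"
    by (intro finsum_additive) (auto simp: adj_add edgesD(1))
  also have "\<dots> = (\<Oplus>e\<in>edges v i. t e \<otimes> adj A (t e))"
    by (intro M.finsum_cong') (auto simp: adj_mult edgesD(1))
  finally show ?thesis using v sum by (simp add: gap_def expand_simps vertex_mor t_vertex(1))
qed

text \<open>Every term can be made to contain \<open>t v \<otimes> t \<mu>\<close>, which vanishes
  because the vertex projections at \<open>v\<close> and at the range of \<open>\<mu>\<close> are
  orthogonal.\<close>

lemma gap_other_range:
  assumes v: "v \<in> vertices \<Lambda>" and \<mu>: "\<mu> \<in> mor \<Lambda>" "rng \<Lambda> \<mu> \<noteq> v"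
  shows "gap \<Lambda> A t v i \<otimes> t \<mu> = \<zero>"
proof -
  have v0: "t v \<otimes> t \<mu> = \<zero>"
  proof -
    have "t v \<otimes> t \<mu> = t v \<otimes> (t (rng \<Lambda> \<mu>) \<otimes> t \<mu>)" using \<mu> by (simp add: t_rng)
    also have "\<dots> = (t v \<otimes> t (rng \<Lambda> \<mu>)) \<otimes> t \<mu>"
      using v \<mu> by (simp add: mult_assoc vertex_mor rng_closed)
    finally show ?thesis using v \<mu> t_vertex(3)[OF v rng_vertex[OF \<mu>(1)]] by simp
  qed
  have "adj A (t e) \<otimes> t \<mu> = \<zero>" if e: "e \<in> edges v i" for e
  proof -
    have "adj A (t e) \<otimes> t \<mu> = adj A (t e) \<otimes> (t v \<otimes> t \<mu>)"
      using adj_t_rng[of e] edgesD[OF e] v \<mu> by (simp add: mult_assoc[symmetric] vertex_mor)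
    then show ?thesis using v0 edgesD(1)[OF e] by simp
  qed
  then have "(\<Oplus>e\<in>edges v i. t e \<otimes> (adj A (t e) \<otimes> t \<mu>)) = \<zero>"
    by (intro M.add.finprod_one_eqI) (simp add: edgesD(1))
  then show ?thesis using v \<mu> v0 by (simp add: gap_mult diff_self)
qed

lemma unit_deg_degrees: "i \<in> {1..k} \<Longrightarrow> unit_deg i \<in> degrees k"
  by (auto simp: unit_deg_def degrees_def)

text \<open>A minimal common extension of two edges of the same degree has that degree itself, so
  both extending paths have degree \<open>0\<close> and unique factorization forces
  \<open>e = f\<close>.\<close>

lemma edges_orthogonal:
  assumes i: "i \<in> {1..k}" and e: "e \<in> edges v i" and f: "f \<in> edges v i" and "e \<noteq> f"
  shows "adj A (t e) \<otimes> t f = \<zero>"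
proof -
  have "min_ext \<Lambda> e f = {}"
  proof (rule ccontr)
    assume "min_ext \<Lambda> e f \<noteq> {}"
    then obtain e' f' where m: "e' \<in> mor \<Lambda>" "f' \<in> mor \<Lambda>" "src \<Lambda> e = rng \<Lambda> e'" "src \<Lambda> f = rng \<Lambda> f'"
      "cmp \<Lambda> e e' = cmp \<Lambda> f f'" and d: "deg \<Lambda> (cmp \<Lambda> e e') = (\<lambda>j. max (deg \<Lambda> e j) (deg \<Lambda> f j))"
      by (auto simp: min_ext_def)
    \<comment> \<open>The summand \<open>0\<close> gives the form that \<open>factorization\<close>
      expects.\<close>
    have d': "deg \<Lambda> (cmp \<Lambda> e e') = (\<lambda>j. unit_deg i j + 0)" using d e f by (simp add: edgesD(3))
    have "deg \<Lambda> e' = (\<lambda>j. 0)" "deg \<Lambda> f' = (\<lambda>j. 0)"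
      using d' deg_comp[OF edgesD(1)[OF e] m(1,3)] deg_comp[OF edgesD(1)[OF f] m(2,4)] m(5)
        edgesD(3)[OF e] edgesD(3)[OF f] by (auto simp: fun_eq_iff)
    moreover have "cmp \<Lambda> e e' \<in> mor \<Lambda>" using comp_closed[OF edgesD(1)[OF e] m(1,3)] .
    moreover have "(\<lambda>j. 0) \<in> degrees k" by (simp add: degrees_def)
    ultimately have "e = f"
      using factorization[OF _ unit_deg_degrees[OF i] _ d'] m edgesD(1,3)[OF e] edgesD(1,3)[OF f] by blast
    then show False using \<open>e \<noteq> f\<close> by simp
  qed
  then show ?thesis using t_adj_t[OF edgesD(1)[OF e] edgesD(1)[OF f]] by simp
qed

text \<open>By orthogonality only the term \<open>e = f\<close> of the sum survives; it is
  \<open>t f\<close>, which cancels \<open>t v \<otimes> t f\<close>.\<close>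

lemma gap_edge:
  assumes i: "i \<in> {1..k}" and v: "v \<in> vertices \<Lambda>" and f: "f \<in> edges v i"
  shows "gap \<Lambda> A t v i \<otimes> t f = \<zero>"
proof -
  have fm: "f \<in> mor \<Lambda>" using edgesD(1)[OF f] .
  have "(\<Oplus>e\<in>edges v i. t e \<otimes> (adj A (t e) \<otimes> t f)) = (\<Oplus>e\<in>edges v i. if f = e then t e else \<zero>)"
    using fm edges_orthogonal[OF i _ f]
    by (intro M.finsum_cong') (auto simp: edgesD(1) t_partial_isometry)
  also have "\<dots> = t f"
    \<comment> \<open>Row-finiteness matters here: a sum over an infinite index set would be
      \<open>\<zero>\<close> by convention.\<close>
    using rows v i by (intro M.finsum_singleton f) (auto simp: row_finite_def edgesD(1))
  finally show ?thesis using t_rng[OF fm] edgesD(2)[OF f] v fm by (simp add: gap_mult diff_self)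
qed

text \<open>If \<open>\<mu>\<close> has range \<open>v\<close>, it factors as \<open>f \<nu>\<close>
  with an edge \<open>f\<close> of degree \<open>unit_deg i\<close>, and the gap kills
  \<open>t f\<close>.\<close>

lemma gap_absorbed:
  assumes i: "i \<in> {1..k}" and v: "v \<in> vertices \<Lambda>" and \<mu>: "\<mu> \<in> mor \<Lambda>" "deg \<Lambda> \<mu> i > 0"
  shows "gap \<Lambda> A t v i \<otimes> t \<mu> = \<zero>"
proof (cases "rng \<Lambda> \<mu> = v")
  case True
  \<comment> \<open>Truncated subtraction is exact because \<open>deg \<Lambda> \<mu> i\<close> is
    positive.\<close>
  let ?n = "\<lambda>j. deg \<Lambda> \<mu> j - unit_deg i j"
  have "?n \<in> degrees k" using deg_closed[OF \<mu>(1)] by (auto simp: degrees_def)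
  moreover have "deg \<Lambda> \<mu> = (\<lambda>j. unit_deg i j + ?n j)" using \<mu>(2) by (auto simp: unit_deg_def fun_eq_iff)
  ultimately obtain f \<nu> where f: "f \<in> mor \<Lambda>" "\<nu> \<in> mor \<Lambda>" "src \<Lambda> f = rng \<Lambda> \<nu>" "\<mu> = cmp \<Lambda> f \<nu>"
    "deg \<Lambda> f = unit_deg i"
    using factorization[OF \<mu>(1) unit_deg_degrees[OF i]] by blast
  have "f \<in> edges v i" using f True rng_comp[OF f(1-3)] by (simp add: paths_to_def paths_def)
  then have "(gap \<Lambda> A t v i \<otimes> t f) \<otimes> t \<nu> = \<zero>" using gap_edge[OF i v] f by simp
  then show ?thesis using t_comp[OF f(1-3)] f v by (simp add: mult_assoc)
qed (use gap_other_range v \<mu> in blast)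

lemma gap_absorbed_adj:
  assumes i: "i \<in> {1..k}" and v: "v \<in> vertices \<Lambda>" and \<mu>: "\<mu> \<in> mor \<Lambda>" "deg \<Lambda> \<mu> i > 0"
  shows "adj A (t \<mu>) \<otimes> gap \<Lambda> A t v i = \<zero>"
  using gap_absorbed[OF assms] adj_mult[of "gap \<Lambda> A t v i" "t \<mu>"] v \<mu> by (simp add: gap_adj)

text \<open>The product vanishes unless \<open>\<mu>\<close> has range \<open>v\<close> and degree
  \<open>0\<close> at \<open>i\<close>. In that case let \<open>g\<close> and \<open>h\<close> be
  the gaps at \<open>v\<close> and at the source: \<open>g t\<^sub>\<mu> = g t\<^sub>\<mu> h\<close>
  because \<open>g\<close> absorbs the paths \<open>\<mu>e\<close>, and
  \<open>g t\<^sub>\<mu> h = t\<^sub>\<mu> h\<close> because \<open>h\<close> absorbs the extensions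
  of \<open>\<mu>\<close>.\<close>

lemma gap_commute:
  assumes i: "i \<in> {1..k}" and v: "v \<in> vertices \<Lambda>" and \<mu>: "\<mu> \<in> mor \<Lambda>"
  shows "gap \<Lambda> A t v i \<otimes> t \<mu> \<in> {\<zero>, t \<mu> \<otimes> gap \<Lambda> A t (src \<Lambda> \<mu>) i}"
proof (cases "rng \<Lambda> \<mu> = v \<and> deg \<Lambda> \<mu> i = 0")
  case True
  let ?g = "gap \<Lambda> A t v i" and ?w = "src \<Lambda> \<mu>"
  let ?h = "gap \<Lambda> A t ?w i" and ?Q = "\<Oplus>e\<in>edges ?w i. t e \<otimes> adj A (t e)"
  note w = src_vertex[OF \<mu>]
  have Q: "?Q \<in> carrier A" by (rule finsum_in_carrier) (simp add: edgesD(1))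
  have "?g \<otimes> t \<mu> \<otimes> ?Q = (\<Oplus>e\<in>edges ?w i. ?g \<otimes> t \<mu> \<otimes> (t e \<otimes> adj A (t e)))"
    using v \<mu> by (intro finsum_additive) (auto simp: distrib_left edgesD(1))
  also have "\<dots> = \<zero>"
  proof (rule M.add.finprod_one_eqI)
    fix e assume e: "e \<in> edges ?w i"
    note e' = edgesD[OF e]
    have "deg \<Lambda> (cmp \<Lambda> \<mu> e) i > 0" using e' \<mu> by (simp add: deg_comp unit_deg_def)
    then have "?g \<otimes> t (cmp \<Lambda> \<mu> e) = \<zero>" using gap_absorbed[OF i v comp_closed[OF \<mu> e'(1)]] e'(2) by simp
    then have "(?g \<otimes> (t \<mu> \<otimes> t e)) \<otimes> adj A (t e) = \<zero>" using t_comp[OF \<mu> e'(1)] e' by simp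
    then show "?g \<otimes> t \<mu> \<otimes> (t e \<otimes> adj A (t e)) = \<zero>" using v \<mu> e' by (simp add: mult_assoc)
  qed
  finally have gQ: "?g \<otimes> t \<mu> \<otimes> ?Q = \<zero>" .
  \<comment> \<open>Inserting \<open>t w = h + Q\<close> on the right gives \<open>g t\<^sub>\<mu> = g t\<^sub>\<mu> h\<close>; then every term of \<open>\<Sum> t\<^sub>e t\<^sub>e\<^sup>* t\<^sub>\<mu> h\<close> vanishes.\<close>
  have "t ?w = ?h \<oplus> ?Q" unfolding gap_def using Q w by (intro diff_add_cancel[symmetric]) (auto simp: vertex_mor)
  then have "?g \<otimes> t \<mu> = ?g \<otimes> (t \<mu> \<otimes> (?h \<oplus> ?Q))"
    using t_src[OF \<mu>] by simp
  also have "\<dots> = ?g \<otimes> (t \<mu> \<otimes> ?h) \<oplus> ?g \<otimes> t \<mu> \<otimes> ?Q"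
    using v w \<mu> Q by (simp add: distrib_left mult_assoc)
  finally have gh: "?g \<otimes> t \<mu> = ?g \<otimes> (t \<mu> \<otimes> ?h)" unfolding gQ using v w \<mu> by simp
  have S0: "(\<Oplus>e\<in>edges v i. t e \<otimes> (adj A (t e) \<otimes> (t \<mu> \<otimes> ?h))) = \<zero>"
  proof (rule M.add.finprod_one_eqI)
    fix e assume e: "e \<in> edges v i"
    note e' = edgesD[OF e]
    have m: "fst p \<in> mor \<Lambda>" "snd p \<in> mor \<Lambda>" if "p \<in> min_ext \<Lambda> e \<mu>" for p
      using that by (auto simp: min_ext_def)
    have "adj A (t e) \<otimes> t \<mu> \<otimes> ?h = (\<Oplus>p\<in>min_ext \<Lambda> e \<mu>. t (fst p) \<otimes> adj A (t (snd p)) \<otimes> ?h)"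
      unfolding t_adj_t[OF e'(1) \<mu>] using w by (intro finsum_additive) (auto simp: distrib_right m)
    also have "\<dots> = \<zero>"
    proof (rule M.add.finprod_one_eqI)
      fix p assume p: "p \<in> min_ext \<Lambda> e \<mu>"
      \<comment> \<open>As \<open>e\<close> has degree \<open>1\<close> at \<open>i\<close> and
        \<open>\<mu>\<close> has degree \<open>0\<close>, the extension of \<open>\<mu>\<close> must
        itself have positive degree at \<open>i\<close>.\<close>
      have "deg \<Lambda> (cmp \<Lambda> \<mu> (snd p)) i = max (deg \<Lambda> e i) (deg \<Lambda> \<mu> i)" "src \<Lambda> \<mu> = rng \<Lambda> (snd p)"
        using p by (auto simp: min_ext_def)
      then have "deg \<Lambda> (snd p) i > 0"
        using True e'(3) deg_comp[OF \<mu> m(2)[OF p]] by (simp add: unit_deg_def)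
      then show "t (fst p) \<otimes> adj A (t (snd p)) \<otimes> ?h = \<zero>"
        using gap_absorbed_adj[OF i w m(2)[OF p]] m[OF p] w by (simp add: mult_assoc)
    qed
    finally show "t e \<otimes> (adj A (t e) \<otimes> (t \<mu> \<otimes> ?h)) = \<zero>" using e' \<mu> w by (simp add: mult_assoc)
  qed
  have "t v \<otimes> (t \<mu> \<otimes> ?h) = t \<mu> \<otimes> ?h"
    using True t_rng[OF \<mu>] v w \<mu> mult_assoc[of "t v" "t \<mu>" ?h] by (simp add: vertex_mor)
  then have "?g \<otimes> (t \<mu> \<otimes> ?h) = t \<mu> \<otimes> ?h \<ominus> \<zero>"
    using gap_mult[OF v, of "t \<mu> \<otimes> ?h" i] S0 w \<mu> by simp
  also have "\<dots> = t \<mu> \<otimes> ?h" using w \<mu> by (simp add: diff_eq_scale)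
  finally show ?thesis using gh by simp
next
  case False
  then show ?thesis using gap_other_range[OF v \<mu>] gap_absorbed[OF i v \<mu>] by auto
qed

lemma gap_commute_adj:
  assumes i: "i \<in> {1..k}" and v: "v \<in> vertices \<Lambda>" and \<mu>: "\<mu> \<in> mor \<Lambda>"
  shows "adj A (t \<mu>) \<otimes> gap \<Lambda> A t v i \<in> {\<zero>, gap \<Lambda> A t (src \<Lambda> \<mu>) i \<otimes> adj A (t \<mu>)}"
proof -
  have "adj A (gap \<Lambda> A t v i \<otimes> t \<mu>) = adj A (t \<mu>) \<otimes> gap \<Lambda> A t v i"
    "adj A (t \<mu> \<otimes> gap \<Lambda> A t (src \<Lambda> \<mu>) i) = gap \<Lambda> A t (src \<Lambda> \<mu>) i \<otimes> adj A (t \<mu>)"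
    using v \<mu> src_vertex[OF \<mu>] by (simp_all add: adj_mult gap_adj)
  then show ?thesis using gap_commute[OF assms] by auto
qed

section \<open>Products of gap elements\<close>

abbreviation gap_prod :: "nat \<Rightarrow> nat list \<Rightarrow> 'l \<Rightarrow> 'a" where
  "gap_prod i l v \<equiv> foldl (\<lambda>x j. x \<otimes> gap \<Lambda> A t v j) (gap \<Lambda> A t v i) l"

lemma gap_prod_closed: "v \<in> vertices \<Lambda> \<Longrightarrow> gap_prod i l v \<in> carrier A"
  by (induction l rule: rev_induct) simp_all

text \<open>The path moves through the factors from the last to the first, shifting each from
  \<open>v\<close> to the source of \<open>\<mu>\<close>; if one factor annihilates it, the whole
  product vanishes.\<close>

lemma gap_prod_commute:
  assumes "i \<in> {1..k}" "set l \<subseteq> {1..k}" and v: "v \<in> vertices \<Lambda>" and \<mu>: "\<mu> \<in> mor \<Lambda>"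
  shows "gap_prod i l v \<otimes> t \<mu> \<in> {\<zero>, t \<mu> \<otimes> gap_prod i l (src \<Lambda> \<mu>)}"
  using assms(2)
proof (induction l rule: rev_induct)
  case Nil
  show ?case using gap_commute[OF assms(1) v \<mu>] by simp
next
  case (snoc j l)
  let ?w = "src \<Lambda> \<mu>"
  note w = src_vertex[OF \<mu>]
  have car: "gap_prod i l v \<in> carrier A" "gap_prod i l ?w \<in> carrier A" using gap_prod_closed v w by auto
  have j: "j \<in> {1..k}" using snoc by simp
  have IH: "gap_prod i l v \<otimes> t \<mu> \<in> {\<zero>, t \<mu> \<otimes> gap_prod i l ?w}" using snoc by simp
  have assoc: "gap_prod i (l @ [j]) v \<otimes> t \<mu> = gap_prod i l v \<otimes> (gap \<Lambda> A t v j \<otimes> t \<mu>)"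
    "gap_prod i l v \<otimes> (t \<mu> \<otimes> gap \<Lambda> A t ?w j) = (gap_prod i l v \<otimes> t \<mu>) \<otimes> gap \<Lambda> A t ?w j"
    "(t \<mu> \<otimes> gap_prod i l ?w) \<otimes> gap \<Lambda> A t ?w j = t \<mu> \<otimes> gap_prod i (l @ [j]) ?w"
    using car v w \<mu> by (simp_all add: mult_assoc)
  consider "gap \<Lambda> A t v j \<otimes> t \<mu> = \<zero>" | "gap \<Lambda> A t v j \<otimes> t \<mu> = t \<mu> \<otimes> gap \<Lambda> A t ?w j" "gap_prod i l v \<otimes> t \<mu> = \<zero>" | "gap \<Lambda> A t v j \<otimes> t \<mu> = t \<mu> \<otimes> gap \<Lambda> A t ?w j" "gap_prod i l v \<otimes> t \<mu> = t \<mu> \<otimes> gap_prod i l ?w"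
    using gap_commute[OF j v \<mu>] IH unfolding insert_iff empty_iff by argo
  then show ?case
  proof cases
    case 1
    then show ?thesis unfolding assoc(1) using car by simp
  next
    case 2
    then show ?thesis unfolding assoc(1) using assoc(2) w by simp
  next
    case 3
    then show ?thesis unfolding assoc(1) using assoc(2,3) by simp
  qed
qed

text \<open>Taking adjoints in \<open>gap_prod_commute\<close> would reverse the order of the
  factors, so the induction is repeated, now from the first factor to the last.\<close>

lemma gap_prod_commute_adj:
  assumes "i \<in> {1..k}" "set l \<subseteq> {1..k}" and v: "v \<in> vertices \<Lambda>" and \<mu>: "\<mu> \<in> mor \<Lambda>"
  shows "adj A (t \<mu>) \<otimes> gap_prod i l v \<in> {\<zero>, gap_prod i l (src \<Lambda> \<mu>) \<otimes> adj A (t \<mu>)}"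
  using assms(2)
proof (induction l rule: rev_induct)
  case Nil
  show ?case using gap_commute_adj[OF assms(1) v \<mu>] by simp
next
  case (snoc j l)
  let ?w = "src \<Lambda> \<mu>"
  note w = src_vertex[OF \<mu>]
  have car: "gap_prod i l v \<in> carrier A" "gap_prod i l ?w \<in> carrier A" using gap_prod_closed v w by auto
  have j: "j \<in> {1..k}" using snoc by simp
  have IH: "adj A (t \<mu>) \<otimes> gap_prod i l v \<in> {\<zero>, gap_prod i l ?w \<otimes> adj A (t \<mu>)}" using snoc by simp
  have assoc: "adj A (t \<mu>) \<otimes> gap_prod i (l @ [j]) v = (adj A (t \<mu>) \<otimes> gap_prod i l v) \<otimes> gap \<Lambda> A t v j"
    "(gap_prod i l ?w \<otimes> adj A (t \<mu>)) \<otimes> gap \<Lambda> A t v j = gap_prod i l ?w \<otimes> (adj A (t \<mu>) \<otimes> gap \<Lambda> A t v j)"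
    "gap_prod i l ?w \<otimes> (gap \<Lambda> A t ?w j \<otimes> adj A (t \<mu>)) = gap_prod i (l @ [j]) ?w \<otimes> adj A (t \<mu>)"
    using car v w \<mu> by (simp_all add: mult_assoc)
  consider "adj A (t \<mu>) \<otimes> gap_prod i l v = \<zero>" | "adj A (t \<mu>) \<otimes> gap_prod i l v = gap_prod i l ?w \<otimes> adj A (t \<mu>)" "adj A (t \<mu>) \<otimes> gap \<Lambda> A t v j = \<zero>" | "adj A (t \<mu>) \<otimes> gap_prod i l v = gap_prod i l ?w \<otimes> adj A (t \<mu>)" "adj A (t \<mu>) \<otimes> gap \<Lambda> A t v j = gap \<Lambda> A t ?w j \<otimes> adj A (t \<mu>)"
    using gap_commute_adj[OF j v \<mu>] IH unfolding insert_iff empty_iff by argo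
  then show ?case
  proof cases
    case 1
    then show ?thesis unfolding assoc(1) using v by simp
  next
    case 2
    then show ?thesis unfolding assoc(1) using assoc(2) car by simp
  next
    case 3
    then show ?thesis unfolding assoc(1) using assoc(2,3) by simp
  qed
qed

text \<open>The split into the minimum and a list of the other indices is the same for all vertices,
  so facts about \<open>gap_prod\<close> apply to the whole set.\<close>

lemma gap_products_list:
  assumes "K \<subseteq> {1..k}" "K \<noteq> {}"
  shows "\<exists>i l. i \<in> {1..k} \<and> set l \<subseteq> {1..k} \<and> gap_products \<Lambda> A t K = gap_prod i l ` vertices \<Lambda>"
proof -
  have fin: "finite K" using assms(1) finite_subset by blast
  then have "Min K \<in> {1..k}" using Min_in[OF _ assms(2)] assms(1) by blast
  moreover have "set (sorted_list_of_set (K - {Min K})) \<subseteq> {1..k}" using fin assms(1) by auto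
  ultimately show ?thesis
    unfolding gap_products_def ordered_prod_def Setcompr_eq_image
    by (intro exI[of _ "Min K"] exI[of _ "sorted_list_of_set (K - {Min K})"]) simp
qed

lemma gap_products_closed: "K \<subseteq> {1..k} \<Longrightarrow> K \<noteq> {} \<Longrightarrow> gap_products \<Lambda> A t K \<subseteq> carrier A"
proof -
  assume "K \<subseteq> {1..k}" "K \<noteq> {}"
  then obtain i l where "gap_products \<Lambda> A t K = gap_prod i l ` vertices \<Lambda>" using gap_products_list by blast
  then show ?thesis using gap_prod_closed by (simp add: image_subset_iff)
qed

section \<open>Monomials and their closed span\<close>

definition monomials :: "'a set" where
  "monomials = {t \<mu> \<otimes> adj A (t \<nu>) | \<mu> \<nu>. \<mu> \<in> mor \<Lambda> \<and> \<nu> \<in> mor \<Lambda> \<and> src \<Lambda> \<mu> = src \<Lambda> \<nu>}"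

lemma monomials_I:
  "\<mu> \<in> mor \<Lambda> \<Longrightarrow> \<nu> \<in> mor \<Lambda> \<Longrightarrow> src \<Lambda> \<mu> = src \<Lambda> \<nu> \<Longrightarrow> t \<mu> \<otimes> adj A (t \<nu>) \<in> monomials"
  unfolding monomials_def by blast

lemma monomials_closed: "monomials \<subseteq> carrier A"
  by (auto simp: monomials_def)

text \<open>(TCK3) expands the middle product \<open>adj A (t \<nu>) \<otimes> t \<sigma>\<close>
  over minimal extensions, and each term composes with the outer factors to a monomial.\<close>

lemma monomials_mult:
  assumes S: "closed_subspace A S" "monomials \<subseteq> S" and x: "x \<in> monomials" and y: "y \<in> monomials"
  shows "x \<otimes> y \<in> S"
proof -
  obtain \<mu> \<nu> where x: "x = t \<mu> \<otimes> adj A (t \<nu>)" "\<mu> \<in> mor \<Lambda>" "\<nu> \<in> mor \<Lambda>" "src \<Lambda> \<mu> = src \<Lambda> \<nu>"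
    using x by (auto simp: monomials_def)
  obtain \<sigma> \<tau> where y: "y = t \<sigma> \<otimes> adj A (t \<tau>)" "\<sigma> \<in> mor \<Lambda>" "\<tau> \<in> mor \<Lambda>" "src \<Lambda> \<sigma> = src \<Lambda> \<tau>"
    using y by (auto simp: monomials_def)
  let ?f = "\<lambda>z. t \<mu> \<otimes> (z \<otimes> adj A (t \<tau>))"
  have m: "fst p \<in> mor \<Lambda>" "snd p \<in> mor \<Lambda>" "src \<Lambda> \<nu> = rng \<Lambda> (fst p)" "src \<Lambda> \<sigma> = rng \<Lambda> (snd p)"
    "cmp \<Lambda> \<nu> (fst p) = cmp \<Lambda> \<sigma> (snd p)" if "p \<in> min_ext \<Lambda> \<nu> \<sigma>" for p
    using that by (auto simp: min_ext_def)
  have "x \<otimes> y = ?f (adj A (t \<nu>) \<otimes> t \<sigma>)" using x y by (simp add: mult_assoc)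
  also have "\<dots> = (\<Oplus>p\<in>min_ext \<Lambda> \<nu> \<sigma>. ?f (t (fst p) \<otimes> adj A (t (snd p))))"
    unfolding t_adj_t[OF x(3) y(2)] using x y
    by (intro finsum_additive) (auto simp: distrib_right distrib_left m)
  also have "\<dots> \<in> S"
  proof (rule finsum_mem[OF S(1)])
    fix p assume p: "p \<in> min_ext \<Lambda> \<nu> \<sigma>"
    note m = m[OF p]
    have "?f (t (fst p) \<otimes> adj A (t (snd p))) = (t \<mu> \<otimes> t (fst p)) \<otimes> adj A (t \<tau> \<otimes> t (snd p))"
      using x y m by (simp add: mult_assoc adj_mult)
    also have "\<dots> = t (cmp \<Lambda> \<mu> (fst p)) \<otimes> adj A (t (cmp \<Lambda> \<tau> (snd p)))"
      using x y m by (simp add: t_comp)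
    also have "\<dots> \<in> monomials"
    proof -
      have "src \<Lambda> (fst p) = src \<Lambda> (snd p)"
        using src_comp[OF x(3) m(1,3)] src_comp[OF y(2) m(2,4)] m(5) by simp
      then show ?thesis using x y m by (intro monomials_I) (simp_all add: comp_closed src_comp)
    qed
    finally show "?f (t (fst p) \<otimes> adj A (t (snd p))) \<in> S" using S(2) by blast
  qed
  finally show ?thesis .
qed

text \<open>The hull is closed under products and adjoints, hence a subalgebra, and it contains the
  generators.\<close>

lemma monomials_span: "closed_subspace A hull monomials = carrier A"
proof -
  let ?H = "closed_subspace A hull monomials"
  have H: "closed_subspace A ?H" by (rule closed_subspace_hull[OF monomials_closed])
  have sub: "monomials \<subseteq> ?H" by (rule hull_subset)
  have HA: "?H \<subseteq> carrier A" using H by (simp add: closed_subspace_def)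
  \<comment> \<open>Closure under products is extended from monomials to the hull one argument at a
    time: first the right factor, then the left.\<close>
  have "?H \<subseteq> {y \<in> carrier A. x \<otimes> y \<in> ?H}" if x: "x \<in> monomials" for x
    using x monomials_closed monomials_mult[OF H sub x]
    by (intro hull_minimal closed_subspace_mult(1)[OF H]) auto
  then have 1: "x \<otimes> y \<in> ?H" if "x \<in> monomials" "y \<in> ?H" for x y using that by blast
  have "?H \<subseteq> {x \<in> carrier A. x \<otimes> y \<in> ?H}" if y: "y \<in> ?H" for y
    using y HA 1 monomials_closed by (intro hull_minimal closed_subspace_mult(2)[OF H]) auto
  then have mult: "x \<otimes> y \<in> ?H" if "x \<in> ?H" "y \<in> ?H" for x y using that by blast
  have "adj A x \<in> monomials" if x: "x \<in> monomials" for x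
  proof -
    obtain \<mu> \<nu> where "x = t \<mu> \<otimes> adj A (t \<nu>)" "\<mu> \<in> mor \<Lambda>" "\<nu> \<in> mor \<Lambda>" "src \<Lambda> \<mu> = src \<Lambda> \<nu>"
      using x unfolding monomials_def by blast
    then show ?thesis using monomials_I[of \<nu> \<mu>] by (simp add: adj_mult)
  qed
  then have "?H \<subseteq> {x \<in> carrier A. adj A x \<in> ?H}"
    using sub monomials_closed by (intro hull_minimal closed_subspace_adj[OF H]) blast
  then have "cstar_subalgebra A ?H" using H mult unfolding cstar_subalgebra_def by blast
  moreover have "t ` mor \<Lambda> \<subseteq> ?H"
  proof
    fix x assume "x \<in> t ` mor \<Lambda>"
    then obtain \<mu> where \<mu>: "\<mu> \<in> mor \<Lambda>" "x = t \<mu>" by blast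
    \<comment> \<open>A generator is a monomial whose second path is its source vertex.\<close>
    then have "x = t \<mu> \<otimes> adj A (t (src \<Lambda> \<mu>))" by (simp add: t_vertex(1) src_vertex t_src)
    then have "x \<in> monomials" using \<mu>(1) monomials_I[of \<mu> "src \<Lambda> \<mu>"] by (simp add: src_closed src_src)
    then show "x \<in> ?H" using sub by blast
  qed
  ultimately have "carrier A \<subseteq> ?H" unfolding generates[symmetric] by (intro hull_minimal)
  then show ?thesis using HA by blast
qed

lemma gap_products_ideal_mult:
  assumes K: "K \<subseteq> {1..k}" "K \<noteq> {}" and L: "L \<subseteq> {1..k}" "L \<noteq> {}"
    and x: "x \<in> ideal_gen A (gap_products \<Lambda> A t K)" and y: "y \<in> ideal_gen A (gap_products \<Lambda> A t L)"
  shows "x \<otimes> y \<in> ideal_gen A {a \<otimes> b | a b. a \<in> gap_products \<Lambda> A t K \<and> b \<in> gap_products \<Lambda> A t L}"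
    (is "_ \<in> ideal_gen A ?P")
proof -
  note KA = gap_products_closed[OF K] and LA = gap_products_closed[OF L]
  have PI: "a \<otimes> b \<in> ?P" if "a \<in> gap_products \<Lambda> A t K" "b \<in> gap_products \<Lambda> A t L" for a b
    using that by blast
  have "?P \<subseteq> carrier A"
  proof
    fix p assume "p \<in> ?P"
    then obtain a b where "p = a \<otimes> b" "a \<in> gap_products \<Lambda> A t K" "b \<in> gap_products \<Lambda> A t L" by blast
    then show "p \<in> carrier A" using KA LA by (simp add: subsetD)
  qed
  note H = ideal_gen_closed_ideal[OF this]
  obtain i l where il: "i \<in> {1..k}" "set l \<subseteq> {1..k}" "gap_products \<Lambda> A t K = gap_prod i l ` vertices \<Lambda>"
    using gap_products_list[OF K] by blast
  obtain j m where jm: "j \<in> {1..k}" "set m \<subseteq> {1..k}" "gap_products \<Lambda> A t L = gap_prod j m ` vertices \<Lambda>"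
    using gap_products_list[OF L] by blast
  show ?thesis
  proof (rule ideal_gen_mult[OF KA LA H _ _ x y])
    fix a b assume ab: "a \<in> gap_products \<Lambda> A t K" "b \<in> gap_products \<Lambda> A t L"
    show "a \<otimes> b \<in> ideal_gen A ?P" using PI[OF ab] subset_ideal_gen by (rule rev_subsetD)
    have abA: "a \<in> carrier A" "b \<in> carrier A" using ab KA LA by (simp_all add: subsetD)
    obtain v where v: "v \<in> vertices \<Lambda>" "a = gap_prod i l v" using ab(1) unfolding il(3) by blast
    obtain w where w: "w \<in> vertices \<Lambda>" "b = gap_prod j m w" using ab(2) unfolding jm(3) by blast
    have mono: "a \<otimes> (z \<otimes> b) \<in> ideal_gen A ?P" if zm: "z \<in> monomials" for z
    proof -
      obtain \<mu> \<nu> where z: "z = t \<mu> \<otimes> adj A (t \<nu>)" "\<mu> \<in> mor \<Lambda>" "\<nu> \<in> mor \<Lambda>"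
        using zm unfolding monomials_def by blast
      \<comment> \<open>The new factors sit at the sources of \<open>\<mu>\<close> and
        \<open>\<nu>\<close>; \<open>?P\<close> contains the products for every pair of
        vertices.\<close>
      let ?a = "gap_prod i l (src \<Lambda> \<mu>)" and ?b = "gap_prod j m (src \<Lambda> \<nu>)"
      have ab': "?a \<in> gap_products \<Lambda> A t K" "?b \<in> gap_products \<Lambda> A t L"
        unfolding il(3) jm(3) using z by (intro imageI src_vertex; simp)+
      then have abA': "?a \<in> carrier A" "?b \<in> carrier A" using KA LA by (simp_all add: subsetD)
      have "?a \<otimes> ?b \<in> ideal_gen A ?P" using PI[OF ab'] subset_ideal_gen by (rule rev_subsetD)
      then have main: "t \<mu> \<otimes> ((?a \<otimes> ?b) \<otimes> adj A (t \<nu>)) \<in> ideal_gen A ?P"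
        using z closed_idealD(7,8)[OF H] by simp
      have assoc: "a \<otimes> (z \<otimes> b) = (a \<otimes> t \<mu>) \<otimes> (adj A (t \<nu>) \<otimes> b)"
        "(t \<mu> \<otimes> ?a) \<otimes> (?b \<otimes> adj A (t \<nu>)) = t \<mu> \<otimes> ((?a \<otimes> ?b) \<otimes> adj A (t \<nu>))"
        using abA abA' z by (simp_all add: mult_assoc)
      have "a \<otimes> t \<mu> = \<zero> \<or> a \<otimes> t \<mu> = t \<mu> \<otimes> ?a"
        using gap_prod_commute[OF il(1,2) v(1) z(2)] v(2) by simp
      moreover have "adj A (t \<nu>) \<otimes> b = \<zero> \<or> adj A (t \<nu>) \<otimes> b = ?b \<otimes> adj A (t \<nu>)"
        using gap_prod_commute_adj[OF jm(1,2) w(1) z(3)] w(2) by simp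
      ultimately consider "a \<otimes> t \<mu> = \<zero>" | "adj A (t \<nu>) \<otimes> b = \<zero>"
        | "a \<otimes> t \<mu> = t \<mu> \<otimes> ?a" "adj A (t \<nu>) \<otimes> b = ?b \<otimes> adj A (t \<nu>)" by argo
      then show ?thesis
      proof cases
        case 1
        then show ?thesis unfolding assoc(1) using abA z closed_idealD(3)[OF H] by simp
      next
        case 2
        then show ?thesis unfolding assoc(1) using abA z closed_idealD(3)[OF H] by simp
      next
        case 3
        then show ?thesis unfolding assoc(1) using assoc(2) main by simp
      qed
    qed
    \<comment> \<open>Membership of \<open>a \<otimes> (z \<otimes> b)\<close> is a closed linear
      condition on \<open>z\<close>, so monomials suffice; the nested preimages let
      \<open>closed_subspace_mult\<close> apply twice.\<close>
    have "closed_subspace A {z \<in> carrier A. z \<otimes> b \<in> {u \<in> carrier A. a \<otimes> u \<in> ideal_gen A ?P}}"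
      using H by (intro closed_subspace_mult abA) (simp add: closed_ideal_def)
    moreover have "monomials \<subseteq> {z \<in> carrier A. z \<otimes> b \<in> {u \<in> carrier A. a \<otimes> u \<in> ideal_gen A ?P}}"
      using mono monomials_closed abA by (auto simp only: mult_closed subset_iff mem_Collect_eq)
    ultimately have "closed_subspace A hull monomials \<subseteq> {z \<in> carrier A. z \<otimes> b \<in> {u \<in> carrier A. a \<otimes> u \<in> ideal_gen A ?P}}"
      by (intro hull_minimal)
    then show "a \<otimes> (z \<otimes> b) \<in> ideal_gen A ?P" if z: "z \<in> carrier A" for z
      using z unfolding monomials_span by blast
  qed
qed

end

section \<open>The commutative diagram with exact rows and columns\<close>

theorem proposition6p10:
  fixes k :: nat and \<Lambda> :: "'l graph" and TC :: "'a cstar" and t :: "'l \<Rightarrow> 'a"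
    and K L :: "nat set" and A B AB :: "'a set"
    and IA IB IAB IU :: "'a set"
  assumes "k_graph k \<Lambda>" and "row_finite k \<Lambda>" and "no_sources k \<Lambda>"
    and "universal_TCK \<Lambda> TC t"
    and "K \<subseteq> {1..k}" and "K \<noteq> {}" and "L \<subseteq> {1..k}" and "L \<noteq> {}"
  defines "A \<equiv> gap_products \<Lambda> TC t K"
    and "B \<equiv> gap_products \<Lambda> TC t L"
    and "AB \<equiv> {a \<otimes>\<^bsub>TC\<^esub> b | a b. a \<in> A \<and> b \<in> B}"
    and "IA \<equiv> ideal_gen TC A"
    and "IB \<equiv> ideal_gen TC B"
    and "IAB \<equiv> ideal_gen TC AB"
    and "IU \<equiv> ideal_gen TC (A \<union> B)"
  defines "incl \<equiv> (\<lambda>x :: 'a. x)"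
    and "qA \<equiv> (\<lambda>x. IA +>\<^bsub>TC\<^esub> x)"
    and "qB \<equiv> (\<lambda>x. IB +>\<^bsub>TC\<^esub> x)"
    and "U \<equiv> TC\<lparr>carrier := IU\<rparr>"
  shows
    \<comment> \<open>rows, then columns, then the four squares\<close>
    "short_exact (TC\<lparr>carrier := IAB\<rparr>) incl (TC\<lparr>carrier := IA\<rparr>) qB (quot U IB) \<and>
     short_exact (TC\<lparr>carrier := IB\<rparr>) incl TC qB (quot TC IB) \<and>
     short_exact (quot U IA) (induced TC IA) (quot TC IA) (induced TC IU) (quot TC IU) \<and>
     short_exact (TC\<lparr>carrier := IAB\<rparr>) incl (TC\<lparr>carrier := IB\<rparr>) qA (quot U IA) \<and>
     short_exact (TC\<lparr>carrier := IA\<rparr>) incl TC qA (quot TC IA) \<and>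
     short_exact (quot U IB) (induced TC IB) (quot TC IB) (induced TC IU) (quot TC IU) \<and>
     (\<forall>x\<in>IAB. incl (incl x) = incl (incl x)) \<and>
     (\<forall>x\<in>IA. induced TC IB (qB x) = qB (incl x)) \<and>
     (\<forall>x\<in>IB. induced TC IA (qA x) = qA (incl x)) \<and>
     (\<forall>x\<in>carrier TC. induced TC IU (qA x) = induced TC IU (qB x))"
proof -
  interpret TCK_algebra TC k \<Lambda> t
    using assms(1,2,4) unfolding universal_TCK_def
    by (intro TCK_algebra.intro cstar_quotients.intro TCK_algebra_axioms.intro) simp_all
  have AB_carrier: "A \<subseteq> carrier TC" "B \<subseteq> carrier TC"
    unfolding A_def B_def using assms(5-8) by (simp_all add: gap_products_closed)
  then have "AB \<subseteq> carrier TC" unfolding AB_def by (auto simp: subset_iff)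
  then have IAB: "closed_ideal TC IAB" unfolding IAB_def by (rule ideal_gen_closed_ideal)
  have IA: "closed_ideal TC IA" and IB: "closed_ideal TC IB" and IU: "closed_ideal TC IU"
    unfolding IA_def IB_def IU_def using AB_carrier by (simp_all add: ideal_gen_closed_ideal)
  have sub: "A \<subseteq> IA" "B \<subseteq> IB" "A \<union> B \<subseteq> IU"
    unfolding IA_def IB_def IU_def by (rule subset_ideal_gen)+
  have IAU: "IA \<subseteq> IU" and IBU: "IB \<subseteq> IU"
    using sub(3) ideal_gen_minimal[OF IU] unfolding IA_def IB_def by simp_all
  have AB_mem: "a \<otimes>\<^bsub>TC\<^esub> b \<in> IA \<inter> IB" if "a \<in> A" "b \<in> B" for a b
    using that sub AB_carrier closed_idealD(8)[OF IA, of b a] closed_idealD(7)[OF IB, of a b]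
    by (simp add: subsetD)
  have "IAB \<subseteq> IA" "IAB \<subseteq> IB"
    using AB_mem unfolding IAB_def AB_def
    by (intro ideal_gen_minimal[OF IA] ideal_gen_minimal[OF IB], blast)+
  moreover have "IA \<inter> IB \<subseteq> IAB"
  proof (rule ideal_Int_subset[OF IA closed_idealD(1)[OF IB] closed_idealD(9)[OF IAB]])
    fix x y assume "x \<in> IA" "y \<in> IB"
    then show "x \<otimes>\<^bsub>TC\<^esub> y \<in> IAB"
      unfolding IA_def IB_def IAB_def A_def B_def AB_def by (rule gap_products_ideal_mult[OF assms(5-8)])
  qed
  \<comment> \<open>This identifies the kernels in the first row and the first column.\<close>
  ultimately have Int: "IAB = IA \<inter> IB" by (intro equalityI Int_greatest)
  let ?S = "{a \<oplus>\<^bsub>TC\<^esub> b | a b. a \<in> IA \<and> b \<in> IB}"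
  have "A \<union> B \<subseteq> ?S"
  proof
    fix x assume x: "x \<in> A \<union> B"
    then have "x \<in> carrier TC" using AB_carrier by blast
    then have "x = x \<oplus>\<^bsub>TC\<^esub> \<zero>\<^bsub>TC\<^esub>" "x = \<zero>\<^bsub>TC\<^esub> \<oplus>\<^bsub>TC\<^esub> x" by simp_all
    then show "x \<in> ?S" using x sub(1,2) closed_idealD(3)[OF IA] closed_idealD(3)[OF IB] by blast
  qed
  \<comment> \<open>The closedness of the sum of two closed ideals enters here; the inclusion yields
    surjectivity in the first row and column.\<close>
  then have IU_sum: "IU \<subseteq> ?S" unfolding IU_def by (rule ideal_gen_minimal[OF ideal_sum[OF IA IB]])
  have split: "\<exists>a\<in>IA. m \<ominus>\<^bsub>TC\<^esub> a \<in> IB" "\<exists>b\<in>IB. m \<ominus>\<^bsub>TC\<^esub> b \<in> IA" if "m \<in> IU" for m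
  proof -
    obtain a b where ab: "m = a \<oplus>\<^bsub>TC\<^esub> b" "a \<in> IA" "b \<in> IB" using IU_sum \<open>m \<in> IU\<close> by blast
    have "a \<in> carrier TC" "b \<in> carrier TC" using closed_idealD(2)[OF IA] closed_idealD(2)[OF IB] ab by simp_all
    then have "m \<ominus>\<^bsub>TC\<^esub> a = b" "m \<ominus>\<^bsub>TC\<^esub> b = a" unfolding ab(1) by (simp_all add: expand_simps M.a_ac scale_combine scale_gap)
    then show "\<exists>a\<in>IA. m \<ominus>\<^bsub>TC\<^esub> a \<in> IB" "\<exists>b\<in>IB. m \<ominus>\<^bsub>TC\<^esub> b \<in> IA"
      using ab(2,3) by (intro bexI[of _ a] bexI[of _ b]; simp)+
  qed
  have onto: "\<exists>n\<in>carrier TC. m \<ominus>\<^bsub>TC\<^esub> n \<in> I" if "closed_ideal TC I" "m \<in> carrier TC" for m I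
    using that closed_idealD(3)[OF that(1)] by (intro bexI[of _ m]) (simp_all add: diff_self)
  have full: "TC\<lparr>carrier := carrier TC\<rparr> = TC" by simp
  have row1: "short_exact (TC\<lparr>carrier := IAB\<rparr>) incl (TC\<lparr>carrier := IA\<rparr>) qB (quot U IB)"
    unfolding incl_def qB_def U_def
    by (rule short_exact_ideal[OF IB IU IA IAU Int split(1)])
  have col1: "short_exact (TC\<lparr>carrier := IAB\<rparr>) incl (TC\<lparr>carrier := IB\<rparr>) qA (quot U IA)"
    unfolding incl_def qA_def U_def
  proof (rule short_exact_ideal[OF IA IU IB IBU])
    show "IAB = IB \<inter> IA" using Int by (simp only: Int_commute)
  qed (rule split(2))
  \<comment> \<open>The second row and column are the case \<open>N = M = carrier TC\<close>, where
    the kernel is \<open>I\<close> itself.\<close>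
  have mid: "short_exact (TC\<lparr>carrier := I\<rparr>) (\<lambda>x. x) TC (\<lambda>x. I +>\<^bsub>TC\<^esub> x) (quot TC I)"
    if I: "closed_ideal TC I" for I
    using short_exact_ideal[OF I closed_ideal_carrier closed_ideal_carrier order_refl _ onto[OF I], of I]
      closed_idealD(1)[OF I] unfolding full by (simp add: Int_absorb1)
  have row3: "short_exact (quot U IA) (induced TC IA) (quot TC IA) (induced TC IU) (quot TC IU)"
    unfolding U_def by (rule short_exact_quot[OF IA IU IAU])
  have col3: "short_exact (quot U IB) (induced TC IB) (quot TC IB) (induced TC IU) (quot TC IU)"
    unfolding U_def by (rule short_exact_quot[OF IB IU IBU])
  \<comment> \<open>On the coset of \<open>x\<close> every induced map returns the coset of the same
    \<open>x\<close> modulo the target ideal, so the squares commute on representatives.\<close>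
  have squares: "\<forall>x\<in>IA. induced TC IB (qB x) = qB (incl x)" "\<forall>x\<in>IB. induced TC IA (qA x) = qA (incl x)"
    "\<forall>x\<in>carrier TC. induced TC IU (qA x) = induced TC IU (qB x)"
    unfolding qA_def qB_def incl_def
    using closed_idealD(2)[OF IA] closed_idealD(2)[OF IB]
    by (simp_all add: induced_coset[OF IA IA order_refl] induced_coset[OF IB IB order_refl]
        induced_coset[OF IA IU IAU] induced_coset[OF IB IU IBU])
  show ?thesis
    using row1 mid[OF IB] row3 col1 mid[OF IA] col3 squares
    unfolding incl_def[symmetric] qA_def[symmetric] qB_def[symmetric] by simp
qed

end
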